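(* For every integer $n\geq 0$ there exist polynomials $q_n,r_n$ in one variable such that, writing $e_2=t_0t_1+t_0t_2+t_1t_2$, $e_3=t_0t_1t_2$ and $T=e_2^3/e_3^2$, the following identities of rational functions in $t_0,t_1,t_2$ hold: if $n\equiv 0 \pmod 3$, $$Z_n^{3C}(t_0,t_1,t_2)=(-1)^{n+1}e_3^{\frac{n(n+2)}3}\left(\frac{e_2^2}{e_3}\,q_n(T)-2^{\chi(n\text{ odd})}\,t_0\,r_n(T)\right);$$ if $n\equiv 1\pmod 3$, $$Z_n^{3C}(t_0,t_1,t_2)=(-1)^{n+1}e_3^{\frac{n(n+2)}3}\left(\frac{t_0t_1}{t_2}\,q_n(T)-2^{\chi(n\text{ odd})}\,\frac{e_2}{t_2}\,r_n(T)\right);$$ if $n\equiv 2\pmod 3$, $$Z_n^{3C}(t_0,t_1,t_2)=(-1)^{n+1}e_3^{\frac{(n+1)^2}3}\left(q_n(T)-2^{\chi(n\text{ odd})}\,\frac{e_2}{t_0t_2}\,r_n(T)\right).$$ Here $\chi(\text{true})=1$ and $\chi(\text{false})=0$.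
   Context: Fix an integer $n\geq 0$. A three-coloured chessboard of size $n$ is a labelling of the squares of an $(n+1)\times(n+1)$ board (rows numbered $1,\dots,n+1$ from top to bottom, columns $1,\dots,n+1$ from left to right) by colours in $\mathbb Z/3\mathbb Z$ such that horizontally or vertically adjacent squares have distinct colours, and such that the boundary colours are fixed as follows: for $1\le i\le n+1$, the squares in positions (row $1$, column $i$), (row $i$, column $1$), (row $n+1$, column $n+2-i$) and (row $n+2-i$, column $n+1$) all have colour $i-1 \bmod 3$. (Equivalently: the north-west and south-east corners have colour $0$ and colours increase by $1$ mod $3$ at each step along the boundary away from these corners.) The partition function is $$Z_n^{3C}(t_0,t_1,t_2)=\sum_{\text{chessboards}}\ \prod_{\text{squares}} t_{\text{colour of the square}}.$$ *)

theory Defs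
  imports Complex_Main "HOL-Library.FuncSet" "HOL-Computational_Algebra.Polynomial"
begin

text \<open>
  Squares are pairs (row, column), both running from 1 to \<open>n + 1\<close>. The colours in
  \<open>\<int>/3\<int>\<close> are represented by their residues 0, 1, 2. A colouring is extensional, that is,
  \<open>undefined\<close> outside the board, so that each labelling of the squares is counted once.
\<close>

definition squares :: "nat \<Rightarrow> (nat \<times> nat) set" where
  "squares n = {1..n+1} \<times> {1..n+1}"

definition chessboards :: "nat \<Rightarrow> (nat \<times> nat \<Rightarrow> nat) set" where
  "chessboards n = {c \<in> squares n \<rightarrow>\<^sub>E {0, 1, 2}.
     (\<forall>i\<in>{1..n+1}. \<forall>j\<in>{1..n}. c (i, j) \<noteq> c (i, j+1)) \<and>
     (\<forall>i\<in>{1..n}. \<forall>j\<in>{1..n+1}. c (i, j) \<noteq> c (i+1, j)) \<and>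
     (\<forall>i\<in>{1..n+1}.
        c (1, i) = (i - 1) mod 3 \<and>
        c (i, 1) = (i - 1) mod 3 \<and>
        c (n+1, n+2-i) = (i - 1) mod 3 \<and>
        c (n+2-i, n+1) = (i - 1) mod 3)}"

lemma finite_chessboards: "finite (chessboards n)"
  by (rule finite_subset[of _ "squares n \<rightarrow>\<^sub>E {0, 1, 2}"])
     (auto simp: chessboards_def squares_def intro: finite_PiE)

definition colour_weight :: "'a \<Rightarrow> 'a \<Rightarrow> 'a \<Rightarrow> nat \<Rightarrow> 'a" where
  "colour_weight t0 t1 t2 k = (if k = 0 then t0 else if k = 1 then t1 else t2)"

definition Z3C :: "nat \<Rightarrow> 'a::comm_semiring_1 \<Rightarrow> 'a \<Rightarrow> 'a \<Rightarrow> 'a" where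
  "Z3C n t0 t1 t2 = (\<Sum>c\<in>chessboards n. \<Prod>s\<in>squares n. colour_weight t0 t1 t2 (c s))"

end

theory Submission
  imports Defs
begin

text \<open>
  Reflecting the board shows that the partition function is symmetric in two of the weights. It is
  therefore a Laurent polynomial in the third weight \<open>t\<close>, homogeneous, with coefficients that are
  polynomials in \<open>e\<^sub>2\<close> and \<open>e\<^sub>3\<close>. The theorem says that only two powers of \<open>t\<close> occur; the shape
  of their coefficients is then forced by homogeneity.

  To bound the powers of \<open>t\<close>, fix \<open>e\<^sub>2\<close> and \<open>e\<^sub>3\<close> and let the weight of one colour \<open>k\<close> tend to infinity
  like \<open>z\<^sup>-\<^sup>2\<close>. The other two weights are then of order \<open>z\<close>, but their sum is of order \<open>z\<^sup>2\<close>. Delete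
  the squares of colour \<open>k\<close>. In each component of the remaining squares that does not meet the
  boundary the two other colours can be exchanged, so that a component of odd size gains a factor \<open>z\<close>.
  A component \<open>C\<close> has at least \<open>|C| - 1\<close> edges. In each block of two by two squares, \<open>C\<close> has as many
  horizontal as vertical edges; summation over the blocks shows that the number of edges of \<open>C\<close> on
  the boundary is even and that, if it is zero, the number of edges of \<open>C\<close> is even. Together with a count of all
  edges this bounds the order of the pole by a quantity that depends only on the four corners.
\<close>

subsection \<open>Edges of subsets of the board\<close>

text \<open>Every term except the two ends is counted twice. Applied along rows and columns, this
  turns sums over blocks or over edges into sums over the whole board with boundary
  corrections.\<close>

lemma sum_adjacent:
  fixes f :: "nat \<Rightarrow> int"
  shows "(\<Sum>i=1..n. f i + f (Suc i)) = 2 * (\<Sum>i=1..Suc n. f i) - f 1 - f (Suc n)"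
  by (induction n) (simp_all add: algebra_simps)

definition hor :: "(nat \<times> nat) set \<Rightarrow> nat \<Rightarrow> nat \<Rightarrow> int" where
  "hor A i j = of_bool ((i, j) \<in> A \<and> (i, Suc j) \<in> A)"

definition ver :: "(nat \<times> nat) set \<Rightarrow> nat \<Rightarrow> nat \<Rightarrow> int" where
  "ver A i j = of_bool ((i, j) \<in> A \<and> (Suc i, j) \<in> A)"

definition edges :: "nat \<Rightarrow> (nat \<times> nat) set \<Rightarrow> int" where
  "edges n A = (\<Sum>i=1..Suc n. \<Sum>j=1..n. hor A i j) + (\<Sum>i=1..n. \<Sum>j=1..Suc n. ver A i j)"

definition rim :: "nat \<Rightarrow> (nat \<times> nat) set \<Rightarrow> int" where
  "rim n A = (\<Sum>j=1..n. hor A 1 j + hor A (Suc n) j) + (\<Sum>i=1..n. ver A i 1 + ver A i (Suc n))"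

lemma rim_nonneg: "0 \<le> rim n A"
  unfolding rim_def hor_def ver_def by (intro add_nonneg_nonneg sum_nonneg) auto

text \<open>Sum the hypothesis over all two by two blocks. A horizontal edge lies in two blocks, or
  in one if it is in the first or last row; likewise for vertical edges and columns. Hence
  \<open>2 * eH - bH = 2 * eV - bV\<close>, which gives \<open>rim n A = 2 * (eH - eV + bV)\<close>.
  If \<open>rim n A\<close> is zero then so are \<open>bH\<close> and \<open>bV\<close>, and
  \<open>eH = eV\<close>.\<close>

lemma rim_edges_parity:
  assumes "\<And>i j. i \<in> {1..n} \<Longrightarrow> j \<in> {1..n} \<Longrightarrow>
    hor A i j + hor A (Suc i) j = ver A i j + ver A i (Suc j)"
  shows "even (rim n A)" and "rim n A = 0 \<Longrightarrow> even (edges n A)"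
proof -
  define eH eV bH bV where "eH = (\<Sum>i=1..Suc n. \<Sum>j=1..n. hor A i j)"
    and "eV = (\<Sum>i=1..n. \<Sum>j=1..Suc n. ver A i j)"
    and "bH = (\<Sum>j=1..n. hor A 1 j + hor A (Suc n) j)"
    and "bV = (\<Sum>i=1..n. ver A i 1 + ver A i (Suc n))"
  have "(\<Sum>j=1..n. \<Sum>i=1..n. hor A i j + hor A (Suc i) j) = 2 * eH - bH"
    unfolding eH_def bH_def sum.swap[of _ "{1..n}" "{1..Suc n}"]
    by (subst sum_adjacent) (simp add: sum_subtractf sum_distrib_left sum.distrib)
  moreover have "(\<Sum>i=1..n. \<Sum>j=1..n. ver A i j + ver A i (Suc j)) = 2 * eV - bV"
    unfolding eV_def bV_def
    by (subst sum_adjacent) (simp add: sum_subtractf sum_distrib_left sum.distrib)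
  moreover have "(\<Sum>j=1..n. \<Sum>i=1..n. hor A i j + hor A (Suc i) j)
      = (\<Sum>i=1..n. \<Sum>j=1..n. ver A i j + ver A i (Suc j))"
    by (subst sum.swap) (intro sum.cong refl assms)
  ultimately have *: "2 * eH - bH = 2 * eV - bV" by simp
  have e: "edges n A = eH + eV" and b: "rim n A = bH + bV"
    by (simp_all add: edges_def rim_def eH_def eV_def bH_def bV_def)
  have "rim n A = 2 * (eH - eV + bV)" using * b by simp
  then show "even (rim n A)" by simp
  have "bH \<ge> 0" "bV \<ge> 0"
    unfolding bH_def bV_def hor_def ver_def by (intro sum_nonneg; simp)+
  then show "even (edges n A)" if "rim n A = 0"
  proof -
    from that b have "bH = 0" "bV = 0"
      using \<open>bH \<ge> 0\<close> \<open>bV \<ge> 0\<close> by linarith+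
    with * have "eH = eV" by linarith
    with e show ?thesis by simp
  qed
qed

text \<open>Comparing unordered pairs makes the relation symmetric by construction.\<close>

definition adj :: "nat \<times> nat \<Rightarrow> nat \<times> nat \<Rightarrow> bool" where
  "adj u v \<longleftrightarrow> (\<exists>i j. {u, v} = {(i, j), (i, Suc j)} \<or> {u, v} = {(i, j), (Suc i, j)})"

lemma adj_sym: "adj u v \<longleftrightarrow> adj v u"
  by (simp add: adj_def insert_commute)

lemma adj_right: "adj (i, j) (i, Suc j)" and adj_down: "adj (i, j) (Suc i, j)"
  unfolding adj_def by blast+

lemma sum_sum_less:
  fixes f g :: "'a \<Rightarrow> 'b \<Rightarrow> int"
  assumes "finite I" "finite J" "\<And>i j. f i j \<le> g i j" "a \<in> I" "b \<in> J" "f a b < g a b"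
  shows "(\<Sum>i\<in>I. \<Sum>j\<in>J. f i j) < (\<Sum>i\<in>I. \<Sum>j\<in>J. g i j)"
proof (rule sum_strict_mono_ex1)
  show "\<exists>i\<in>I. (\<Sum>j\<in>J. f i j) < (\<Sum>j\<in>J. g i j)"
    using assms by (intro bexI[of _ a] sum_strict_mono_ex1) auto
qed (use assms in \<open>auto intro: sum_mono\<close>)

lemma edges_mono: "A \<subseteq> B \<Longrightarrow> hor A i j \<le> hor B i j" "A \<subseteq> B \<Longrightarrow> ver A i j \<le> ver B i j"
  by (auto simp: hor_def ver_def)

text \<open>No edge is lost, and the edge between \<open>u\<close> and \<open>v\<close> is new
  because \<open>v\<close> was missing.\<close>

lemma edges_insert:
  assumes "B \<subseteq> squares n" "v \<in> squares n" "u \<in> B" "v \<notin> B" "adj u v"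
  shows "edges n B < edges n (insert v B)"
proof -
  have mono: "(\<Sum>i=1..Suc n. \<Sum>j=1..n. hor B i j) \<le> (\<Sum>i=1..Suc n. \<Sum>j=1..n. hor (insert v B) i j)"
    "(\<Sum>i=1..n. \<Sum>j=1..Suc n. ver B i j) \<le> (\<Sum>i=1..n. \<Sum>j=1..Suc n. ver (insert v B) i j)"
    by (intro sum_mono edges_mono; blast)+
  from \<open>adj u v\<close> obtain i j where "{u, v} = {(i, j), (i, Suc j)} \<or> {u, v} = {(i, j), (Suc i, j)}"
    unfolding adj_def by blast
  then show ?thesis
  proof
    assume uv: "{u, v} = {(i, j), (i, Suc j)}"
    then have in_sq: "(i, j) \<in> squares n" "(i, Suc j) \<in> squares n"
      using assms by (auto simp: doubleton_eq_iff)
    have "(\<Sum>i=1..Suc n. \<Sum>j=1..n. hor B i j) < (\<Sum>i=1..Suc n. \<Sum>j=1..n. hor (insert v B) i j)"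
    proof (rule sum_sum_less[of _ _ _ _ i j])
      show "hor B i j < hor (insert v B) i j"
        using uv assms by (auto simp: hor_def doubleton_eq_iff)
    qed (use in_sq in \<open>auto simp: squares_def hor_def\<close>)
    then show ?thesis using mono by (simp add: edges_def)
  next
    assume uv: "{u, v} = {(i, j), (Suc i, j)}"
    then have in_sq: "(i, j) \<in> squares n" "(Suc i, j) \<in> squares n"
      using assms by (auto simp: doubleton_eq_iff)
    have "(\<Sum>i=1..n. \<Sum>j=1..Suc n. ver B i j) < (\<Sum>i=1..n. \<Sum>j=1..Suc n. ver (insert v B) i j)"
    proof (rule sum_sum_less[of _ _ _ _ i j])
      show "ver B i j < ver (insert v B) i j"
        using uv assms by (auto simp: ver_def doubleton_eq_iff)
    qed (use in_sq in \<open>auto simp: squares_def ver_def\<close>)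
    then show ?thesis using mono by (simp add: edges_def)
  qed
qed

lemma edges_nonneg: "0 \<le> edges n A"
  unfolding edges_def hor_def ver_def by (intro add_nonneg_nonneg sum_nonneg) auto

text \<open>The hypothesis \<open>crossing\<close> is connectedness. Starting from one square, a
  subset of \<open>C\<close> is enlarged by one adjacent square at a time, and each enlargement
  creates an edge; this is the count of a spanning tree.\<close>

lemma card_le_edges:
  assumes "C \<subseteq> squares n"
    and crossing: "\<And>B. B \<subset> C \<Longrightarrow> B \<noteq> {} \<Longrightarrow> \<exists>u\<in>B. \<exists>v\<in>C - B. adj u v"
  shows "int (card C) \<le> edges n C + 1"
proof -
  have fin: "finite C" using assms(1) by (rule finite_subset) (simp add: squares_def)
  have "\<exists>B\<subseteq>C. card B = Suc m \<and> int m \<le> edges n B" if "Suc m \<le> card C" for m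
    using that
  proof (induction m)
    case 0
    then obtain r where "r \<in> C" by (metis card.empty not_one_le_zero One_nat_def ex_in_conv)
    then show ?case using edges_nonneg by (intro exI[of _ "{r}"]) auto
  next
    case (Suc m)
    then obtain B where B: "B \<subseteq> C" "card B = Suc m" "int m \<le> edges n B" by auto
    with Suc.prems have "B \<subset> C" "B \<noteq> {}" by auto
    then obtain u v where uv: "u \<in> B" "v \<in> C" "v \<notin> B" "adj u v" using crossing by blast
    have "edges n B < edges n (insert v B)"
      using edges_insert[of B n v u] B uv assms(1) by blast
    then show ?case
      using B uv fin by (intro exI[of _ "insert v B"]) (auto simp: card_insert_if finite_subset)
  qed
  from this[of "card C - 1"] show ?thesis
  proof (cases "card C = 0")
    case False
    then obtain B where B: "B \<subseteq> C" "card B = card C" "int (card C - 1) \<le> edges n B"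
      using \<open>Suc (card C - 1) \<le> card C \<Longrightarrow> _\<close> by force
    then have "B = C" using fin card_subset_eq by blast
    with B False show ?thesis by simp
  qed (use edges_nonneg in simp)
qed

section \<open>Connected components of a set of squares\<close>

definition link :: "(nat \<times> nat) set \<Rightarrow> ((nat \<times> nat) \<times> (nat \<times> nat)) set" where
  "link X = {(u, v). u \<in> X \<and> v \<in> X \<and> adj u v}"

definition components :: "(nat \<times> nat) set \<Rightarrow> (nat \<times> nat) set set" where
  "components X = (\<lambda>u. (link X)\<^sup>* `` {u}) ` X"

lemma link_rtrancl_sym: "(u, v) \<in> (link X)\<^sup>* \<Longrightarrow> (v, u) \<in> (link X)\<^sup>*"
  by (rule symD[OF sym_rtrancl]) (auto simp: link_def sym_def adj_sym)

lemma component_subset: "C \<in> components X \<Longrightarrow> C \<subseteq> X"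
proof -
  have "v \<in> X" if "(u, v) \<in> (link X)\<^sup>*" "u \<in> X" for u v
    using that by (induction rule: rtrancl_induct) (auto simp: link_def)
  then show "C \<in> components X \<Longrightarrow> C \<subseteq> X" by (auto simp: components_def)
qed

lemma component_eq: "C \<in> components X \<Longrightarrow> u \<in> C \<Longrightarrow> C = (link X)\<^sup>* `` {u}"
proof -
  assume "C \<in> components X" "u \<in> C"
  then obtain w where w: "C = (link X)\<^sup>* `` {w}" "(w, u) \<in> (link X)\<^sup>*"
    unfolding components_def by blast
  show "C = (link X)\<^sup>* `` {u}"
    unfolding w(1) using w(2) link_rtrancl_sym[OF w(2)] by (auto intro: rtrancl_trans)
qed

lemma components_disjoint: "C \<in> components X \<Longrightarrow> D \<in> components X \<Longrightarrow> u \<in> C \<Longrightarrow> u \<in> D \<Longrightarrow> C = D"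
  using component_eq by metis

lemma Union_components: "\<Union>(components X) = X"
proof
  show "X \<subseteq> \<Union>(components X)" unfolding components_def by auto
qed (use component_subset in blast)

lemma component_closed:
  assumes "C \<in> components X" "u \<in> C" "v \<in> X" "adj u v"
  shows "v \<in> C"
proof -
  have "(u, v) \<in> link X" using assms component_subset by (auto simp: link_def)
  then show ?thesis using component_eq[OF assms(1,2)] by auto
qed

text \<open>A path in \<open>C\<close> from a square of \<open>B\<close> to a square outside
  \<open>B\<close> has to leave \<open>B\<close> along some edge.\<close>

lemma component_crossing:
  assumes "C \<in> components X" "B \<subset> C" "B \<noteq> {}"
  shows "\<exists>u\<in>B. \<exists>v\<in>C - B. adj u v"
proof (rule ccontr)
  assume neg: "\<not> ?thesis"
  from assms obtain u w where uw: "u \<in> B" "w \<in> C" "w \<notin> B" by blast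
  then have "(u, w) \<in> (link X)\<^sup>*" using component_eq[OF assms(1), of u] assms(2) by auto
  then have "w \<in> B"
  proof (induction rule: rtrancl_induct)
    case (step y z)
    then have "y \<in> C" "z \<in> X" "adj y z" using assms(2) by (auto simp: link_def)
    then have "z \<in> C" using component_closed[OF assms(1)] by blast
    then show ?case using step neg \<open>adj y z\<close> by blast
  qed (rule uw)
  with uw show False by blast
qed

text \<open>By \<open>cover\<close>, two adjacent squares have signs adding up to -2 or 0, according
  to whether both lie in \<open>X\<close> or only one does. So twice the indicator of an edge is
  minus the sum of two signs, and edge counts become sums of signs.\<close>

lemma edges_count:
  fixes s :: "nat \<times> nat \<Rightarrow> int"
  assumes X: "X \<subseteq> squares n"
    and cover: "\<And>u v. u \<in> squares n \<Longrightarrow> v \<in> squares n \<Longrightarrow> adj u v \<Longrightarrow> u \<in> X \<or> v \<in> X"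
  defines "s \<equiv> \<lambda>v. if v \<in> X then -1 else 1"
  shows "4 * int (card (squares n - X)) + 2 * edges n X + rim n X =
    4 * int (card X) + (s (1, 1) + s (1, Suc n) + s (Suc n, 1) + s (Suc n, Suc n))"
proof -
  have h: "2 * hor X i j = - (s (i, j) + s (i, Suc j))"
    if "i \<in> {1..Suc n}" "j \<in> {1..n}" for i j
    using cover[of "(i, j)" "(i, Suc j)"] that by (auto simp: hor_def s_def squares_def adj_right)
  have v: "2 * ver X i j = - (s (i, j) + s (Suc i, j))"
    if "i \<in> {1..n}" "j \<in> {1..Suc n}" for i j
    using cover[of "(i, j)" "(Suc i, j)"] that by (auto simp: ver_def s_def squares_def adj_down)
  define tot where "tot = (\<Sum>i=1..Suc n. \<Sum>j=1..Suc n. s (i, j))"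
  define L R U D where "L = (\<Sum>i=1..Suc n. s (i, 1))" and "R = (\<Sum>i=1..Suc n. s (i, Suc n))"
    and "U = (\<Sum>j=1..Suc n. s (1, j))" and "D = (\<Sum>j=1..Suc n. s (Suc n, j))"
  have "2 * (\<Sum>i=1..Suc n. \<Sum>j=1..n. hor X i j) = - (\<Sum>i=1..Suc n. \<Sum>j=1..n. s (i, j) + s (i, Suc j))"
    unfolding sum_distrib_left sum_negf[symmetric] by (intro sum.cong refl h)
  also have "\<dots> = - (2 * tot - L - R)"
    unfolding sum_adjacent[of "\<lambda>j. s (_, j)"] tot_def L_def R_def
    by (simp only: sum_subtractf sum_distrib_left)
  finally have eH: "2 * (\<Sum>i=1..Suc n. \<Sum>j=1..n. hor X i j) = - (2 * tot - L - R)" .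
  have "2 * (\<Sum>j=1..Suc n. \<Sum>i=1..n. ver X i j) = - (\<Sum>j=1..Suc n. \<Sum>i=1..n. s (i, j) + s (Suc i, j))"
    unfolding sum_distrib_left sum_negf[symmetric] by (intro sum.cong refl v)
  also have "\<dots> = - (2 * (\<Sum>j=1..Suc n. \<Sum>i=1..Suc n. s (i, j)) - U - D)"
    unfolding sum_adjacent[of "\<lambda>i. s (i, _)"] U_def D_def
    by (simp only: sum_subtractf sum_distrib_left)
  finally have eV: "2 * (\<Sum>i=1..n. \<Sum>j=1..Suc n. ver X i j) = - (2 * tot - U - D)"
    unfolding tot_def by (subst (asm) (1 2) sum.swap) 
  have "2 * (\<Sum>j=1..n. hor X 1 j + hor X (Suc n) j) =
      - ((\<Sum>j=1..n. s (1, j) + s (1, Suc j)) + (\<Sum>j=1..n. s (Suc n, j) + s (Suc n, Suc j)))"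
    unfolding sum_distrib_left sum.distrib[symmetric] sum_negf[symmetric]
    using h[of 1] h[of "Suc n"] by (intro sum.cong refl) (auto simp: algebra_simps)
  then have bH: "2 * (\<Sum>j=1..n. hor X 1 j + hor X (Suc n) j) =
      - (2 * U - s (1, 1) - s (1, Suc n) + (2 * D - s (Suc n, 1) - s (Suc n, Suc n)))"
    unfolding sum_adjacent[of "\<lambda>j. s (_, j)"] U_def D_def by simp
  have "2 * (\<Sum>i=1..n. ver X i 1 + ver X i (Suc n)) =
      - ((\<Sum>i=1..n. s (i, 1) + s (Suc i, 1)) + (\<Sum>i=1..n. s (i, Suc n) + s (Suc i, Suc n)))"
    unfolding sum_distrib_left sum.distrib[symmetric] sum_negf[symmetric]
    using v[of _ 1] v[of _ "Suc n"] by (intro sum.cong refl) (auto simp: algebra_simps)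
  then have bV: "2 * (\<Sum>i=1..n. ver X i 1 + ver X i (Suc n)) =
      - (2 * L - s (1, 1) - s (Suc n, 1) + (2 * R - s (1, Suc n) - s (Suc n, Suc n)))"
    unfolding sum_adjacent[of "\<lambda>i. s (i, _)"] L_def R_def by simp
  have fin: "finite (squares n)" by (simp add: squares_def)
  have "tot = (\<Sum>v\<in>squares n. s v)"
    unfolding tot_def by (simp add: sum.cartesian_product squares_def del: sum.cl_ivl_Suc)
  also have "\<dots> = (\<Sum>v\<in>squares n - X. s v) + (\<Sum>v\<in>X. s v)"
    using X fin by (rule sum.subset_diff)
  also have "\<dots> = int (card (squares n - X)) - int (card X)"
    by (simp add: s_def)
  finally have "tot = int (card (squares n - X)) - int (card X)" .
  \<comment> \<open>The sums of signs along the four sides enter \<open>2 * edges n X\<close> and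
    \<open>rim n X\<close> with opposite signs and cancel. Only the corners, which belong to two
    sides each, survive.\<close>
  moreover have "x1 = - (2 * t - l - r) \<Longrightarrow> x2 = - (2 * t - u - d) \<Longrightarrow>
      2 * b1 = - (2 * u - p - q + (2 * d - p' - q')) \<Longrightarrow> 2 * b2 = - (2 * l - p - p' + (2 * r - q - q')) \<Longrightarrow>
      t = a - x \<Longrightarrow> 4 * a + (x1 + x2) + (b1 + b2) = 4 * x + (p + q + p' + q')"
    for x1 x2 t l r u d b1 b2 p q p' q' a x :: int
    by linarith
  ultimately show ?thesis
    using eH eV bH bV unfolding edges_def rim_def distrib_left[of 2] by blast
qed

section \<open>Chessboards and the squares that avoid a colour\<close>

definition off_colour :: "nat \<Rightarrow> nat \<Rightarrow> (nat \<times> nat \<Rightarrow> nat) \<Rightarrow> (nat \<times> nat) set" where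
  "off_colour n k c = {v \<in> squares n. c v \<noteq> k}"

lemma chessboard_adj:
  assumes "c \<in> chessboards n" "u \<in> squares n" "v \<in> squares n" "adj u v"
  shows "c u \<noteq> c v"
proof -
  obtain i j where "{u, v} = {(i, j), (i, Suc j)} \<or> {u, v} = {(i, j), (Suc i, j)}"
    using assms(4) unfolding adj_def by blast
  then show ?thesis
  proof
    assume uv: "{u, v} = {(i, j), (i, Suc j)}"
    then have "i \<in> {1..n+1}" "j \<in> {1..n}"
      using assms(2,3) by (auto simp: doubleton_eq_iff squares_def)
    then have "c (i, j) \<noteq> c (i, j + 1)" using assms(1) unfolding chessboards_def by blast
    with uv show ?thesis by (auto simp: doubleton_eq_iff)
  next
    assume uv: "{u, v} = {(i, j), (Suc i, j)}"
    then have "i \<in> {1..n}" "j \<in> {1..n+1}"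
      using assms(2,3) by (auto simp: doubleton_eq_iff squares_def)
    then have "c (i, j) \<noteq> c (i + 1, j)" using assms(1) unfolding chessboards_def by blast
    with uv show ?thesis by (auto simp: doubleton_eq_iff)
  qed
qed

text \<open>The substitution of \<open>n + 2 - i\<close> for \<open>i\<close> lets the last row and
  column be read in the same direction as the first ones.\<close>

lemma chessboard_boundary:
  assumes "c \<in> chessboards n" "i \<in> {1..Suc n}"
  shows "c (1, i) = (i - 1) mod 3" "c (i, 1) = (i - 1) mod 3"
    "c (Suc n, i) = (Suc n - i) mod 3" "c (i, Suc n) = (Suc n - i) mod 3"
proof -
  have *: "c (1, i) = (i - 1) mod 3 \<and> c (i, 1) = (i - 1) mod 3 \<and>
    c (n+1, n+2-i) = (i - 1) mod 3 \<and> c (n+2-i, n+1) = (i - 1) mod 3" if "i \<in> {1..n+1}" for i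
    using assms(1) that unfolding chessboards_def by blast
  from assms(2) have "n + 2 - i \<in> {1..n+1}" "n + 2 - (n + 2 - i) = i" "n + 2 - i - 1 = Suc n - i"
    by auto
  with *[OF this(1)] *[of i] assms(2)
  show "c (1, i) = (i - 1) mod 3" "c (i, 1) = (i - 1) mod 3"
    "c (Suc n, i) = (Suc n - i) mod 3" "c (i, Suc n) = (Suc n - i) mod 3" by auto
qed

text \<open>No two adjacent squares of the block have colour \<open>k\<close>. If at most one square
  has colour \<open>k\<close>, the others are connected within the block, so \<open>C\<close>
  contains all of them or none; if two opposite squares have colour \<open>k\<close>, the block has
  no edge. In each case the horizontal and vertical edges are equal in number.\<close>

lemma block_balance:
  assumes c: "c \<in> chessboards n" and C: "C \<in> components (off_colour n k c)"
    and "i \<in> {1..n}" "j \<in> {1..n}"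
  shows "hor C i j + hor C (Suc i) j = ver C i j + ver C i (Suc j)"
proof -
  let ?X = "off_colour n k c"
  have sq: "(i, j) \<in> squares n" "(i, Suc j) \<in> squares n" "(Suc i, j) \<in> squares n" "(Suc i, Suc j) \<in> squares n"
    using assms(3,4) by (auto simp: squares_def)
  have cover: "u \<in> ?X \<or> v \<in> ?X" if "u \<in> squares n" "v \<in> squares n" "adj u v" for u v
    using chessboard_adj[OF c that] that by (auto simp: off_colour_def)
  have closed: "u \<in> C \<and> v \<in> ?X \<longrightarrow> v \<in> C" "v \<in> C \<and> u \<in> ?X \<longrightarrow> u \<in> C" if "adj u v" for u v
    using component_closed[OF C] that adj_sym by blast+
  have sub: "v \<in> C \<longrightarrow> v \<in> ?X" for v
    using component_subset[OF C] by blast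
  let ?a = "(i, j)" and ?b = "(i, Suc j)" and ?c = "(Suc i, j)" and ?d = "(Suc i, Suc j)"
  have adj: "adj ?a ?b" "adj ?c ?d" "adj ?a ?c" "adj ?b ?d"
    by (simp_all add: adj_right adj_down)
  have X: "?a \<in> ?X \<or> ?b \<in> ?X" "?c \<in> ?X \<or> ?d \<in> ?X" "?a \<in> ?X \<or> ?c \<in> ?X" "?b \<in> ?X \<or> ?d \<in> ?X"
    using cover adj sq by blast+
  \<comment> \<open>Capital letters stand for membership in \<open>?X\<close>, small letters for
    membership in \<open>C\<close>. The two horizontal edges are matched with the two vertical ones
    in one of the two possible ways.\<close>
  have "(a \<and> b) = (a \<and> c) \<and> (c \<and> d) = (b \<and> d) \<or> (a \<and> b) = (b \<and> d) \<and> (c \<and> d) = (a \<and> c)"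
    if "A \<or> B" "C \<or> D" "A \<or> C" "B \<or> D" "a \<and> B \<longrightarrow> b" "b \<and> A \<longrightarrow> a" "c \<and> D \<longrightarrow> d" "d \<and> C \<longrightarrow> c"
      "a \<and> C \<longrightarrow> c" "c \<and> A \<longrightarrow> a" "b \<and> D \<longrightarrow> d" "d \<and> B \<longrightarrow> b"
      "a \<longrightarrow> A" "b \<longrightarrow> B" "c \<longrightarrow> C" "d \<longrightarrow> D" for a b c d A B C D :: bool
    using that by argo
  from this[OF X closed[OF adj(1)] closed[OF adj(2)] closed[OF adj(3)] closed[OF adj(4)] sub sub sub sub]
  show ?thesis unfolding hor_def ver_def by auto
qed

definition interior :: "nat \<Rightarrow> (nat \<times> nat) set" where
  "interior n = {2..n} \<times> {2..n}"

text \<open>The corners of a colour other than \<open>k\<close> whose neighbours all have colour \<open>k\<close>.\<close>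

definition lone_corners :: "nat \<Rightarrow> nat \<Rightarrow> (nat \<times> nat) set" where
  "lone_corners n k = (if k = 1 then {(1, 1), (Suc n, Suc n)} else {}) \<union>
     (if k = (n + 2) mod 3 then {(1, Suc n), (Suc n, 1)} else {})"

subsection \<open>Components of the squares that avoid a colour\<close>

text \<open>The two neighbours of a square on a side have different colours, so at most one of them
  has colour \<open>k\<close>. At an end of the side only one neighbour is left; it has colour 1 or
  \<open>(n + 2) mod 3\<close>, and these are the exceptional cases.\<close>

lemma side_neighbour:
  fixes n j k :: nat
  assumes "j \<in> {1..Suc n}" "k < 3" "(j - 1) mod 3 \<noteq> k"
  obtains "j \<le> n" "j mod 3 \<noteq> k" | "2 \<le> j" "(j - 2) mod 3 \<noteq> k"
    | "j = 1" "k = 1" | "j = Suc n" "k = (n + 2) mod 3"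
proof -
  have mod: "j mod 3 \<noteq> (j - 2) mod 3" if "2 \<le> j"
  proof -
    have "j = Suc (Suc (j - 2))" using that by simp
    moreover have "Suc (Suc m) mod 3 \<noteq> m mod 3" for m :: nat by (simp add: mod_Suc)
    ultimately show ?thesis by metis
  qed
  have "(j = 1 \<and> n = 0) \<or> (j = 1 \<and> 1 \<le> n) \<or> (j = Suc n \<and> 1 \<le> n) \<or> (2 \<le> j \<and> j \<le> n)"
    using assms(1) by auto
  then consider "j = 1" "n = 0" | "j = 1" "1 \<le> n" | "j = Suc n" "1 \<le> n" | "2 \<le> j" "j \<le> n"
    by blast
  then show thesis
  proof cases
    \<comment> \<open>The single square of a board with \<open>n = 0\<close> has colour 0, so
      \<open>k\<close> is 1 or 2, and 2 is \<open>(n + 2) mod 3\<close>.\<close>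
    case 1
    with assms have "k \<noteq> 0" by simp
    with 1 assms(2) have "k = 1 \<or> k = (n + 2) mod 3" by simp linarith
    with 1 that(3,4) show thesis by auto
  next
    case 2
    then show thesis using that(1,3) by (cases "k = 1") auto
  next
    case 3
    then obtain m where "n = Suc m" by (cases n) auto
    then have "(j - 2) mod 3 = (n + 2) mod 3" using 3 by (simp add: mod_simps)
    moreover have "2 \<le> j" using 3 by simp
    ultimately show thesis using 3(1) that(2,4) by (cases "k = (n + 2) mod 3") auto
  next
    case 4
    with mod have "j mod 3 \<noteq> k \<or> (j - 2) mod 3 \<noteq> k" by auto
    with 4 that(1,2) show thesis by blast
  qed
qed

lemma rim_pos_hor: "i = 1 \<or> i = Suc n \<Longrightarrow> j \<in> {1..n} \<Longrightarrow> hor A i j = 1 \<Longrightarrow> 0 < rim n A"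
proof -
  assume *: "i = 1 \<or> i = Suc n" "j \<in> {1..n}" "hor A i j = 1"
  have "0 < (\<Sum>j=1..n. hor A 1 j + hor A (Suc n) j)"
    using * by (intro sum_pos2[of _ j]) (auto simp: hor_def split: if_splits)
  moreover have "0 \<le> (\<Sum>i=1..n. ver A i 1 + ver A i (Suc n))"
    by (intro sum_nonneg) (auto simp: ver_def)
  ultimately show ?thesis by (simp add: rim_def)
qed

lemma rim_pos_ver: "j = 1 \<or> j = Suc n \<Longrightarrow> i \<in> {1..n} \<Longrightarrow> ver A i j = 1 \<Longrightarrow> 0 < rim n A"
proof -
  assume *: "j = 1 \<or> j = Suc n" "i \<in> {1..n}" "ver A i j = 1"
  have "0 < (\<Sum>i=1..n. ver A i 1 + ver A i (Suc n))"
    using * by (intro sum_pos2[of _ i]) (auto simp: ver_def split: if_splits)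
  moreover have "0 \<le> (\<Sum>j=1..n. hor A 1 j + hor A (Suc n) j)"
    by (intro sum_nonneg) (auto simp: hor_def)
  ultimately show ?thesis by (simp add: rim_def)
qed

text \<open>Along a side the colours other than \<open>k\<close> come in adjacent pairs, except possibly at the ends.\<close>

lemma rim_pos:
  assumes c: "c \<in> chessboards n" and "k < 3" and C: "C \<in> components (off_colour n k c)"
    and "\<not> C \<subseteq> interior n" and lone: "C \<inter> lone_corners n k = {}"
  shows "0 < rim n C"
proof -
  let ?X = "off_colour n k c"
  obtain a b where ab: "(a, b) \<in> C" "(a, b) \<notin> interior n" using assms(4) by auto
  then have X: "(a, b) \<in> ?X" using component_subset[OF C] by blast
  then have sq: "a \<in> {1..Suc n}" "b \<in> {1..Suc n}" and ck: "c (a, b) \<noteq> k"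
    by (auto simp: off_colour_def squares_def)
  have notlone: "(a, b) \<notin> lone_corners n k" using ab lone by blast
  have inX: "(i, j) \<in> ?X" if "i \<in> {1..Suc n}" "j \<in> {1..Suc n}" "c (i, j) \<noteq> k" for i j
    using that by (auto simp: off_colour_def squares_def)
  have right: "hor C i j = 1" if "(i, j) \<in> C" "(i, Suc j) \<in> ?X" for i j
    using component_closed[OF C that adj_right] that by (simp add: hor_def)
  have left: "hor C i j = 1" if "(i, Suc j) \<in> C" "(i, j) \<in> ?X" for i j
    using component_closed[OF C that] adj_sym adj_right that by (simp add: hor_def)
  have down: "ver C i j = 1" if "(i, j) \<in> C" "(Suc i, j) \<in> ?X" for i j
    using component_closed[OF C that adj_down] that by (simp add: ver_def)
  have up: "ver C i j = 1" if "(Suc i, j) \<in> C" "(i, j) \<in> ?X" for i j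
    using component_closed[OF C that] adj_sym adj_down that by (simp add: ver_def)
  note bd = chessboard_boundary[OF c]
  consider "a = 1" | "a = Suc n" | "b = 1" | "b = Suc n"
    using ab(2) sq by (auto simp: interior_def)
  then show ?thesis
  proof cases
    case 1
    have "(b - 1) mod 3 \<noteq> k" using ck bd(1)[OF sq(2)] 1 by simp
    with sq(2) \<open>k < 3\<close> show ?thesis
    proof (cases rule: side_neighbour)
      case a: 1
      then have m: "Suc b \<in> {1..Suc n}" "Suc b - 1 = b" using sq by auto
      have "(1, Suc b) \<in> ?X"
      proof (rule inX)
        show "c (1, Suc b) \<noteq> k" unfolding bd(1)[OF m(1)] m(2) by fact
      qed (use m in auto)
      with ab 1 have "hor C 1 b = 1" by (intro right) auto
      then show ?thesis using a sq by (intro rim_pos_hor[of 1 n b]) auto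
    next
      case a: 2
      then have m: "b - 1 \<in> {1..Suc n}" "b - 1 - 1 = b - 2" using sq by auto
      have "(1, b - 1) \<in> ?X"
      proof (rule inX)
        show "c (1, b - 1) \<noteq> k" unfolding bd(1)[OF m(1)] m(2) by fact
      qed (use m in auto)
      with ab 1 a have "hor C 1 (b - 1) = 1" by (intro left) auto
      then show ?thesis using a sq by (intro rim_pos_hor[of 1 n "b - 1"]) auto
    next
      case 3
      with \<open>a = 1\<close> notlone show ?thesis by (simp add: lone_corners_def)
    next
      case 4
      with \<open>a = 1\<close> notlone show ?thesis by (simp add: lone_corners_def)
    qed
  next
    case 3
    have "(a - 1) mod 3 \<noteq> k" using ck bd(2)[OF sq(1)] 3 by simp
    with sq(1) \<open>k < 3\<close> show ?thesis
    proof (cases rule: side_neighbour)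
      case b: 1
      then have m: "Suc a \<in> {1..Suc n}" "Suc a - 1 = a" using sq by auto
      have "(Suc a, 1) \<in> ?X"
      proof (rule inX)
        show "c (Suc a, 1) \<noteq> k" unfolding bd(2)[OF m(1)] m(2) by fact
      qed (use m in auto)
      with ab 3 have "ver C a 1 = 1" by (intro down) auto
      then show ?thesis using b sq by (intro rim_pos_ver[of 1 n a]) auto
    next
      case b: 2
      then have m: "a - 1 \<in> {1..Suc n}" "a - 1 - 1 = a - 2" using sq by auto
      have "(a - 1, 1) \<in> ?X"
      proof (rule inX)
        show "c (a - 1, 1) \<noteq> k" unfolding bd(2)[OF m(1)] m(2) by fact
      qed (use m in auto)
      with ab 3 b have "ver C (a - 1) 1 = 1" by (intro up) auto
      then show ?thesis using b sq by (intro rim_pos_ver[of 1 n "a - 1"]) auto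
    next
      case 3
      with \<open>b = 1\<close> notlone show ?thesis by (simp add: lone_corners_def)
    next
      case 4
      with \<open>b = 1\<close> notlone show ?thesis by (simp add: lone_corners_def)
    qed
  next
    case 2
    \<comment> \<open>In the last row the colours increase from right to left. Counting from the
      right makes \<open>side_neighbour\<close> applicable and exchanges the roles of the left and
      right neighbours; the last column is treated in the same way.\<close>
    define b' where "b' = n + 2 - b"
    have b': "b' \<in> {1..Suc n}" "b = n + 2 - b'" "b' - 1 = Suc n - b" using sq by (auto simp: b'_def)
    have "(b' - 1) mod 3 \<noteq> k" using ck bd(3)[OF sq(2)] 2 b' by simp
    with b'(1) \<open>k < 3\<close> show ?thesis
    proof (cases rule: side_neighbour)
      case a: 2
      then have m: "Suc b \<in> {1..Suc n}" "Suc n - (Suc b) = b' - 2" using b' by auto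
      have "(Suc n, Suc b) \<in> ?X"
      proof (rule inX)
        show "c (Suc n, Suc b) \<noteq> k" unfolding bd(3)[OF m(1)] m(2) by fact
      qed (use m in auto)
      with ab 2 have "hor C (Suc n) b = 1" by (intro right) auto
      then show ?thesis using a b' by (intro rim_pos_hor[of "Suc n" n b]) auto
    next
      case a: 1
      then have m: "b - 1 \<in> {1..Suc n}" "Suc n - (b - 1) = b'" "Suc (b - 1) = b" using b' by auto
      have "(Suc n, b - 1) \<in> ?X"
      proof (rule inX)
        show "c (Suc n, b - 1) \<noteq> k" unfolding bd(3)[OF m(1)] m(2) by fact
      qed (use m in auto)
      with ab 2 m(3) have "hor C (Suc n) (b - 1) = 1" by (intro left) auto
      then show ?thesis using a b' by (intro rim_pos_hor[of "Suc n" n "b - 1"]) auto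
    next
      case 3
      with \<open>a = Suc n\<close> notlone b'(2) show ?thesis by (simp add: lone_corners_def)
    next
      case 4
      with \<open>a = Suc n\<close> notlone b'(2) show ?thesis by (simp add: lone_corners_def)
    qed
  next
    case 4
    define a' where "a' = n + 2 - a"
    have a': "a' \<in> {1..Suc n}" "a = n + 2 - a'" "a' - 1 = Suc n - a" using sq by (auto simp: a'_def)
    have "(a' - 1) mod 3 \<noteq> k" using ck bd(4)[OF sq(1)] 4 a' by simp
    with a'(1) \<open>k < 3\<close> show ?thesis
    proof (cases rule: side_neighbour)
      case b: 2
      then have m: "Suc a \<in> {1..Suc n}" "Suc n - (Suc a) = a' - 2" using a' by auto
      have "(Suc a, Suc n) \<in> ?X"
      proof (rule inX)
        show "c (Suc a, Suc n) \<noteq> k" unfolding bd(4)[OF m(1)] m(2) by fact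
      qed (use m in auto)
      with ab 4 have "ver C a (Suc n) = 1" by (intro down) auto
      then show ?thesis using b a' by (intro rim_pos_ver[of "Suc n" n a]) auto
    next
      case b: 1
      then have m: "a - 1 \<in> {1..Suc n}" "Suc n - (a - 1) = a'" "Suc (a - 1) = a" using a' by auto
      have "(a - 1, Suc n) \<in> ?X"
      proof (rule inX)
        show "c (a - 1, Suc n) \<noteq> k" unfolding bd(4)[OF m(1)] m(2) by fact
      qed (use m in auto)
      with ab 4 m(3) have "ver C (a - 1) (Suc n) = 1" by (intro up) auto
      then show ?thesis using b a' by (intro rim_pos_ver[of "Suc n" n "a - 1"]) auto
    next
      case 3
      with \<open>b = Suc n\<close> notlone a'(2) show ?thesis by (simp add: lone_corners_def)
    next
      case 4
      with \<open>b = Suc n\<close> notlone a'(2) show ?thesis by (simp add: lone_corners_def)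
    qed
  qed
qed

lemma rim_interior:
  assumes "C \<subseteq> interior n"
  shows "rim n C = 0"
proof -
  have *: "i \<noteq> 1 \<and> i \<noteq> Suc n \<and> j \<noteq> 1 \<and> j \<noteq> Suc n" if "(i, j) \<in> C" for i j
    using that assms by (auto simp: interior_def)
  have "hor C 1 j = 0" "hor C (Suc n) j = 0" "ver C j 1 = 0" "ver C j (Suc n) = 0" for j
    using *[of 1 j] *[of "Suc n" j] *[of j 1] *[of j "Suc n"] by (auto simp: hor_def ver_def)
  then show ?thesis by (simp add: rim_def)
qed

text \<open>Connectedness alone bounds the left side by 2, which is enough if \<open>C\<close>
  contains a lone corner. Otherwise, if \<open>C\<close> meets the boundary, then
  \<open>rim n C\<close> is positive and even, hence at least 2, and absorbs this bound. If
  \<open>C\<close> is interior, the number of its edges is even, so the bound is attained only by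
  components of odd size.\<close>

lemma component_excess:
  assumes c: "c \<in> chessboards n" and k: "k < 3" and C: "C \<in> components (off_colour n k c)"
  shows "2 * int (card C) - 2 * edges n C - rim n C \<le>
    2 * of_bool (C \<subseteq> interior n \<and> odd (card C)) + 2 * of_bool (C \<inter> lone_corners n k \<noteq> {})"
proof -
  have "C \<subseteq> squares n" using component_subset[OF C] by (auto simp: off_colour_def)
  then have tree: "int (card C) \<le> edges n C + 1"
    using component_crossing[OF C] by (rule card_le_edges)
  have parity: "even (rim n C)" "rim n C = 0 \<Longrightarrow> even (edges n C)"
    using rim_edges_parity[of n C] block_balance[OF c C] by blast+
  show ?thesis
  proof (cases "C \<inter> lone_corners n k = {}")
    case True
    show ?thesis
    proof (cases "C \<subseteq> interior n")
      case interior: True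
      then have "rim n C = 0" by (rule rim_interior)
      with parity have "even (edges n C)" by blast
      with tree have "int (card C) \<le> edges n C + of_bool (odd (card C))"
        by (cases "int (card C) = edges n C + 1") (auto simp: even_of_nat_iff[symmetric, where 'a=int] simp del: even_of_nat_iff)
      with interior \<open>rim n C = 0\<close> show ?thesis by simp
    next
      case False
      obtain m where "rim n C = 2 * m" using parity(1) by (rule evenE)
      with rim_pos[OF c k C False True] have "rim n C \<ge> 2" by simp
      with tree show ?thesis by simp
    qed
  next
    case False
    with tree rim_nonneg[of n C] show ?thesis by simp
  qed
qed

section \<open>Summation over components\<close>

lemma sum_components_pair:
  assumes "finite X" "adj u v"
  shows "(\<Sum>C\<in>components X. of_bool (u \<in> C \<and> v \<in> C)) = (of_bool (u \<in> X \<and> v \<in> X) :: int)"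
proof (cases "u \<in> X \<and> v \<in> X")
  case True
  then obtain D where D: "D \<in> components X" "u \<in> D" using Union_components[of X] by blast
  then have "v \<in> D" using component_closed True assms(2) by blast
  have "u \<in> C \<and> v \<in> C \<longleftrightarrow> C = D" if "C \<in> components X" for C
    using components_disjoint[OF that D(1)] D \<open>v \<in> D\<close> by blast
  then have "(\<Sum>C\<in>components X. of_bool (u \<in> C \<and> v \<in> C)) = (\<Sum>C\<in>components X. if C = D then 1 else 0 :: int)"
    by (intro sum.cong refl) auto
  also have "\<dots> = 1" using D(1) \<open>finite X\<close> by (simp add: components_def)
  finally show ?thesis using True by simp
next
  case False
  then show ?thesis using component_subset by (intro trans[OF sum.neutral]) auto
qed

lemma finite_components: "finite X \<Longrightarrow> finite (components X)"
  by (simp add: components_def)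

lemma sum_components:
  assumes "finite X"
  shows "(\<Sum>C\<in>components X. \<Sum>v\<in>C. f v) = (\<Sum>v\<in>X. f v)"
proof -
  have "sum f (\<Union>(components X)) = (sum \<circ> sum) f (components X)"
  proof (rule sum.Union_disjoint)
    show "\<forall>A\<in>components X. finite A" using assms component_subset finite_subset by blast
    show "\<forall>A\<in>components X. \<forall>B\<in>components X. A \<noteq> B \<longrightarrow> A \<inter> B = {}"
      using components_disjoint by blast
  qed
  then show ?thesis by (simp add: Union_components)
qed

text \<open>An edge of \<open>X\<close> lies in exactly one component, because adjacent squares of
  \<open>X\<close> are never separated.\<close>

lemma sum_components_edges:
  assumes "finite X"
  shows "(\<Sum>C\<in>components X. edges n C) = edges n X" "(\<Sum>C\<in>components X. rim n C) = rim n X"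
proof -
  have h: "(\<Sum>C\<in>components X. hor C i j) = hor X i j" for i j
    unfolding hor_def by (rule sum_components_pair[OF assms adj_right])
  have v: "(\<Sum>C\<in>components X. ver C i j) = ver X i j" for i j
    unfolding ver_def by (rule sum_components_pair[OF assms adj_down])
  show "(\<Sum>C\<in>components X. edges n C) = edges n X"
    unfolding edges_def sum.distrib sum.swap[of _ _ "components X"] h v ..
  show "(\<Sum>C\<in>components X. rim n C) = rim n X"
    unfolding rim_def sum.distrib sum.swap[of _ _ "components X"] h v ..
qed

text \<open>Choose a square of \<open>Q\<close> in each such component; disjointness of the
  components makes the choice injective.\<close>

lemma card_components_meeting:
  assumes "finite Q"
  shows "card {C \<in> components X. C \<inter> Q \<noteq> {}} \<le> card Q"
proof -
  have "\<forall>C\<in>{C \<in> components X. C \<inter> Q \<noteq> {}}. \<exists>v. v \<in> C \<and> v \<in> Q" by blast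
  then obtain f where f: "\<forall>C\<in>{C \<in> components X. C \<inter> Q \<noteq> {}}. f C \<in> C \<and> f C \<in> Q"
    by (rule bchoice[THEN exE])
  show ?thesis
  proof (rule card_inj_on_le)
    show "inj_on f {C \<in> components X. C \<inter> Q \<noteq> {}}"
    proof (rule inj_onI)
      fix C D
      assume "C \<in> {C \<in> components X. C \<inter> Q \<noteq> {}}" "D \<in> {C \<in> components X. C \<inter> Q \<noteq> {}}"
        and "f C = f D"
      with f show "C = D" using components_disjoint[of C X D "f C"] by force
    qed
    show "f ` {C \<in> components X. C \<inter> Q \<noteq> {}} \<subseteq> Q" using f by blast
  qed (rule assms)
qed

text \<open>The bound on the order of the pole when the weight of \<open>k\<close> tends to infinity.\<close>

definition pole_order :: "nat \<Rightarrow> nat \<Rightarrow> int" where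
  "pole_order n k = 2 - 2 * of_bool (k = 2) - 2 * of_bool (k = (n + 1) mod 3)"

text \<open>The left side is the order of the pole: 2 for every square of colour \<open>k\<close>,
  -1 for every other square, and a further -1 for every odd interior component. Summing
  \<open>component_excess\<close> over the components bounds
  \<open>2 * int (card X) - 2 * edges n X - rim n X\<close>, and \<open>edges_count\<close>
  eliminates the edges, so that only contributions of the corners remain.\<close>

lemma off_colour_bound:
  assumes c: "c \<in> chessboards n" and k: "k < 3"
  defines "X \<equiv> off_colour n k c"
  shows "2 * int (card (squares n - X)) - int (card X)
    - int (card {C \<in> components X. C \<subseteq> interior n \<and> odd (card C)}) \<le> pole_order n k"
proof -
  let ?\<phi> = "card {C \<in> components X. C \<subseteq> interior n \<and> odd (card C)}"
  let ?Q = "lone_corners n k"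
  have X: "X \<subseteq> squares n" by (auto simp: X_def off_colour_def)
  have fin: "finite X" using X by (rule finite_subset) (simp add: squares_def)
  have e1: "(\<Sum>C\<in>components X. 2 * int (card C) - 2 * edges n C - rim n C)
      = 2 * int (card X) - 2 * edges n X - rim n X"
    using sum_components[OF fin, of "\<lambda>_. 1::int"]
    by (simp add: sum_subtractf sum_distrib_left[symmetric] sum_components_edges[OF fin])
  have e2: "(\<Sum>C\<in>components X. 2 * int (card C) - 2 * edges n C - rim n C) \<le>
      (\<Sum>C\<in>components X. 2 * of_bool (C \<subseteq> interior n \<and> odd (card C)) + 2 * of_bool (C \<inter> ?Q \<noteq> {}))"
    unfolding X_def by (intro sum_mono component_excess[OF c k])
  have e3: "(\<Sum>C\<in>components X. 2 * of_bool (C \<subseteq> interior n \<and> odd (card C)) + 2 * of_bool (C \<inter> ?Q \<noteq> {}))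
      = 2 * int ?\<phi> + 2 * int (card {C \<in> components X. C \<inter> ?Q \<noteq> {}})"
    using finite_components[OF fin]
    by (simp add: sum.distrib sum_distrib_left[symmetric] Int_def)
  have e4: "int (card {C \<in> components X. C \<inter> ?Q \<noteq> {}}) \<le> int (card ?Q)"
    unfolding of_nat_le_iff by (rule card_components_meeting) (simp add: lone_corners_def)
  have e5: "int (card ?Q) \<le> 2 * of_bool (k = 1) + 2 * of_bool (k = (n + 2) mod 3)"
  proof -
    have "card ?Q \<le> card (if k = 1 then {(1, 1), (Suc n, Suc n)} else {})
        + card (if k = (n + 2) mod 3 then {(1, Suc n), (Suc n, 1)} else {})"
      unfolding lone_corners_def by (rule card_Un_le)
    also have "\<dots> \<le> 2 * of_bool (k = 1) + 2 * of_bool (k = (n + 2) mod 3)"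
      by (auto simp: card_insert_if)
    finally have "int (card ?Q) \<le> int (2 * of_bool (k = 1) + 2 * of_bool (k = (n + 2) mod 3))"
      unfolding of_nat_le_iff .
    then show ?thesis by simp
  qed
  \<comment> \<open>The corners (1, 1) and (n + 1, n + 1) have colour 0, the other two have colour
    \<open>n mod 3\<close>. A corner has sign 1 exactly if its colour is \<open>k\<close>.\<close>
  have e6: "4 * int (card (squares n - X)) + 2 * edges n X + rim n X =
    4 * int (card X) + (4 * of_bool (k = 0) + 4 * of_bool (k = n mod 3) - 4)"
  proof -
    define s :: "nat \<times> nat \<Rightarrow> int" where "s = (\<lambda>v. if v \<in> X then -1 else 1)"
    have "4 * int (card (squares n - X)) + 2 * edges n X + rim n X =
      4 * int (card X) + (s (1, 1) + s (1, Suc n) + s (Suc n, 1) + s (Suc n, Suc n))"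
      unfolding s_def
    proof (rule edges_count[OF X])
      show "u \<in> X \<or> v \<in> X" if "u \<in> squares n" "v \<in> squares n" "adj u v" for u v
        using chessboard_adj[OF c that] that by (auto simp: X_def off_colour_def)
    qed
    moreover have "s (1, 1) = 2 * of_bool (k = 0) - 1" "s (Suc n, Suc n) = 2 * of_bool (k = 0) - 1"
      "s (1, Suc n) = 2 * of_bool (k = n mod 3) - 1" "s (Suc n, 1) = 2 * of_bool (k = n mod 3) - 1"
      using chessboard_boundary[OF c, of 1] chessboard_boundary[OF c, of "Suc n"]
      by (auto simp: s_def X_def off_colour_def squares_def)
    ultimately show ?thesis by simp
  qed
  \<comment> \<open>Exactly one of 0, 1, 2 equals \<open>k\<close>, and exactly one of the residues
    of \<open>n\<close>, \<open>n + 1\<close>, \<open>n + 2\<close> does.\<close>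
  have e7: "of_bool (k = 1) + of_bool (k = (n + 2) mod 3) + of_bool (k = 0) + of_bool (k = n mod 3) - 1
      = 1 - of_bool (k = 2) - (of_bool (k = (n + 1) mod 3) :: int)"
  proof -
    have k1: "k = 0 \<or> k = 1 \<or> k = 2" using k by auto
    have k2: "(n mod 3, (n + 1) mod 3, (n + 2) mod 3) \<in> {(0, 1, 2), (1, 2, 0), (2, 0, 1)}"
    proof -
      have "n mod 3 < 3" by simp
      then consider "n mod 3 = 0" | "n mod 3 = 1" | "n mod 3 = 2" by linarith
      then show ?thesis by cases (simp_all add: mod_Suc)
    qed
    have k3: "of_bool (k = 1) + of_bool (k = r) + of_bool (k = 0) + of_bool (k = p) - 1
        = 1 - of_bool (k = 2) - (of_bool (k = q) :: int)"
      if "k = 0 \<or> k = 1 \<or> k = 2" "(p, q, r) \<in> {(0, 1, 2), (1, 2, 0), (2, 0, 1)}" for p q r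
      using that unfolding insert_iff empty_iff prod.inject
      by (elim disjE conjE FalseE; hypsubst; simp)
    show ?thesis by (rule k3[OF k1 k2])
  qed
  have e8: "L = 2 * x - 2 * e - b \<Longrightarrow> L \<le> R \<Longrightarrow> R = 2 * f + 2 * m \<Longrightarrow> m \<le> q \<Longrightarrow>
      q \<le> 2 * k1 + 2 * k2 \<Longrightarrow> 4 * s + 2 * e + b = 4 * x + (4 * k0 + 4 * k3 - 4) \<Longrightarrow>
      k1 + k2 + k0 + k3 - 1 = 1 - l - l' \<Longrightarrow> 2 * s - x - f \<le> 2 - 2 * l - 2 * l'"
    for L x e b R f m q k0 k1 k2 k3 s l l' :: int
    by linarith
  show ?thesis unfolding pole_order_def by (rule e8[OF e1 e2 e3 e4 e5 e6 e7])
qed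

subsection \<open>Orders of vanishing\<close>

text \<open>This is f = O(z^m) for z tending to 0 from the right, where a negative \<open>m\<close>
  allows a pole. One constant serves the whole interval (0, 1], so no limits are involved.\<close>

definition order_ge :: "(real \<Rightarrow> complex) \<Rightarrow> int \<Rightarrow> bool" where
  "order_ge f m \<longleftrightarrow> (\<exists>K. \<forall>z. 0 < z \<and> z \<le> 1 \<longrightarrow> norm (f z) \<le> K * z powi m)"

text \<open>The value at 1 shows that the constant is nonnegative, which monotonicity and products
  of bounds rely on.\<close>

lemma order_geE:
  assumes "order_ge f m"
  obtains K where "0 \<le> K" "\<And>z. 0 < z \<Longrightarrow> z \<le> 1 \<Longrightarrow> norm (f z) \<le> K * z powi m"
proof -
  obtain K where K: "0 < z \<Longrightarrow> z \<le> 1 \<Longrightarrow> norm (f z) \<le> K * z powi m" for z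
    using assms unfolding order_ge_def by blast
  from K[of 1] have "0 \<le> K" using norm_ge_zero[of "f 1"] by (simp del: norm_ge_zero)
  with K that show thesis by blast
qed

lemma order_ge_mono:
  assumes "order_ge f m" "l \<le> m"
  shows "order_ge f l"
proof -
  obtain K where K: "0 \<le> K" "\<And>z. 0 < z \<Longrightarrow> z \<le> 1 \<Longrightarrow> norm (f z) \<le> K * z powi m"
    using assms(1) order_geE by metis
  have "norm (f z) \<le> K * z powi l" if "0 < z" "z \<le> 1" for z
  proof -
    have "z powi m \<le> z powi l" using that assms(2) by (intro power_int_decreasing) auto
    with K(2)[OF that] K(1) show ?thesis by (meson mult_left_mono order_trans)
  qed
  then show ?thesis unfolding order_ge_def by blast
qed

lemma order_ge_const: "order_ge (\<lambda>_. a) 0"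
  unfolding order_ge_def by (intro exI[of _ "norm a"]) simp

lemma order_ge_add:
  assumes "order_ge f m" "order_ge g m"
  shows "order_ge (\<lambda>z. f z + g z) m"
proof -
  obtain K L where "\<And>z. 0 < z \<Longrightarrow> z \<le> 1 \<Longrightarrow> norm (f z) \<le> K * z powi m"
    "\<And>z. 0 < z \<Longrightarrow> z \<le> 1 \<Longrightarrow> norm (g z) \<le> L * z powi m"
    using assms order_geE by metis
  then have "norm (f z + g z) \<le> (K + L) * z powi m" if "0 < z" "z \<le> 1" for z
    using that by (intro order_trans[OF norm_triangle_ineq]) (simp add: distrib_right add_mono)
  then show ?thesis unfolding order_ge_def by blast
qed

lemma order_ge_mult:
  assumes "order_ge f m" "order_ge g l"
  shows "order_ge (\<lambda>z. f z * g z) (m + l)"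
proof -
  obtain K L where "0 \<le> K" "0 \<le> L" "\<And>z. 0 < z \<Longrightarrow> z \<le> 1 \<Longrightarrow> norm (f z) \<le> K * z powi m"
    "\<And>z. 0 < z \<Longrightarrow> z \<le> 1 \<Longrightarrow> norm (g z) \<le> L * z powi l"
    using assms order_geE by metis
  then have "norm (f z * g z) \<le> (K * L) * z powi (m + l)" if "0 < z" "z \<le> 1" for z
    using that mult_mono[of "norm (f z)" "K * z powi m" "norm (g z)" "L * z powi l"]
    by (simp add: norm_mult power_int_add mult_ac)
  then show ?thesis unfolding order_ge_def by blast
qed

lemma order_ge_cmult: "order_ge f m \<Longrightarrow> order_ge (\<lambda>z. a * f z) m"
  using order_ge_mult[OF order_ge_const] by simp

lemma order_ge_zero: "order_ge (\<lambda>_. 0) m"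
  unfolding order_ge_def by (intro exI[of _ 0]) simp

lemma order_ge_sum: "(\<And>a. a \<in> A \<Longrightarrow> order_ge (f a) m) \<Longrightarrow> order_ge (\<lambda>z. \<Sum>a\<in>A. f a z) m"
  by (induction A rule: infinite_finite_induct) (auto intro: order_ge_add order_ge_zero)

lemma order_ge_prod:
  "(\<And>a. a \<in> A \<Longrightarrow> order_ge (f a) (m a)) \<Longrightarrow> order_ge (\<lambda>z. \<Prod>a\<in>A. f a z) (\<Sum>a\<in>A. m a)"
  by (induction A rule: infinite_finite_induct) (auto intro: order_ge_mult order_ge_const)

lemma order_ge_power: "order_ge f m \<Longrightarrow> order_ge (\<lambda>z. f z ^ k) (int k * m)"
proof (induction k)
  case (Suc k)
  have "order_ge (\<lambda>z. f z * f z ^ k) (m + int k * m)"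
    by (rule order_ge_mult[OF Suc.prems Suc.IH[OF Suc.prems]])
  then show ?case by (simp add: algebra_simps)
qed (simp add: order_ge_const)

text \<open>Power sums satisfy p(m+2) = (x + y) p(m+1) - x y p(m). The extra order of x + y
  propagates to all odd exponents.\<close>

lemma order_ge_power_sum:
  assumes x: "order_ge x 1" and y: "order_ge y 1" and xy: "order_ge (\<lambda>z. x z + y z) 2"
  shows "order_ge (\<lambda>z. x z ^ m + y z ^ m) (int m + of_bool (odd m))"
proof (induction m rule: induct_nat_012)
  case (ge2 m)
  have "order_ge (\<lambda>z. (x z + y z) * (x z ^ Suc m + y z ^ Suc m)) (2 + (int (Suc m) + of_bool (odd (Suc m))))"
    by (rule order_ge_mult[OF xy ge2(2)])
  then have 1: "order_ge (\<lambda>z. (x z + y z) * (x z ^ Suc m + y z ^ Suc m))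
      (int (Suc (Suc m)) + of_bool (odd (Suc (Suc m))))"
    by (rule order_ge_mono) simp
  have "order_ge (\<lambda>z. - 1 * ((x z * y z) * (x z ^ m + y z ^ m))) ((1 + 1) + (int m + of_bool (odd m)))"
    by (rule order_ge_cmult[OF order_ge_mult[OF order_ge_mult[OF x y] ge2(1)]])
  then have 2: "order_ge (\<lambda>z. - 1 * ((x z * y z) * (x z ^ m + y z ^ m)))
      (int (Suc (Suc m)) + of_bool (odd (Suc (Suc m))))"
    by (rule order_ge_mono) simp
  show ?case
    using order_ge_add[OF 1 2] by (simp add: algebra_simps)
next
  case 0
  show ?case using order_ge_const[of 2] by simp
qed (use xy in simp)

text \<open>Taking out the smaller power of x y leaves a power sum whose exponent has the parity of
  \<open>a + b\<close>.\<close>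

lemma order_ge_symmetric_monomial:
  assumes x: "order_ge x 1" and y: "order_ge y 1" and xy: "order_ge (\<lambda>z. x z + y z) 2"
  shows "order_ge (\<lambda>z. x z ^ a * y z ^ b + y z ^ a * x z ^ b) (int (a + b) + of_bool (odd (a + b)))"
proof -
  have *: "order_ge (\<lambda>z. x z ^ a * y z ^ (a + d) + y z ^ a * x z ^ (a + d))
      (int (a + (a + d)) + of_bool (odd (a + (a + d))))" for a d
  proof -
    have "order_ge (\<lambda>z. (x z * y z) ^ a * (x z ^ d + y z ^ d)) (int a * (1 + 1) + (int d + of_bool (odd d)))"
      by (intro order_ge_mult order_ge_power order_ge_power_sum x y xy)
    moreover have "int a * (1 + 1) + (int d + of_bool (odd d)) =
        int (a + (a + d)) + of_bool (odd (a + (a + d)))"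
      by (simp flip: add.assoc)
    moreover have "(x z * y z) ^ a * (x z ^ d + y z ^ d) = x z ^ a * y z ^ (a + d) + y z ^ a * x z ^ (a + d)" for z
      by (simp add: power_add power_mult_distrib algebra_simps)
    ultimately show ?thesis by (simp only:)
  qed
  show ?thesis
  proof (cases "a \<le> b")
    case True
    then show ?thesis using *[of a "b - a"] by simp
  next
    case False
    then show ?thesis using *[of b "a - b"] by (simp add: mult.commute add.commute)
  qed
qed

subsection \<open>Flipping components\<close>

text \<open>The involution of the colours that fixes \<open>k\<close>.\<close>

definition switch :: "nat \<Rightarrow> nat \<Rightarrow> nat" where
  "switch k a = (2 * k + 2 * a) mod 3"

lemma less_3_cases: "k < 3 \<Longrightarrow> k \<in> {0, 1, 2 :: nat}"
  by auto

lemma switch_simps: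
  "switch 0 0 = 0" "switch 0 1 = 2" "switch 0 2 = 1"
  "switch 1 0 = 2" "switch 1 1 = 1" "switch 1 2 = 0"
  "switch 2 0 = 1" "switch 2 1 = 0" "switch 2 2 = 2"
  by (simp_all add: switch_def)

lemma switch_less: "switch k a \<in> {0, 1, 2}"
  using less_3_cases[of "switch k a"] by (simp add: switch_def)

lemma switch_switch: "k \<in> {0, 1, 2} \<Longrightarrow> a \<in> {0, 1, 2} \<Longrightarrow> switch k (switch k a) = a"
  by (elim insertE emptyE; hypsubst; simp only: switch_simps)

lemma switch_eq_iff: "k \<in> {0, 1, 2} \<Longrightarrow> a \<in> {0, 1, 2} \<Longrightarrow> switch k a = k \<longleftrightarrow> a = k"
  by (elim insertE emptyE; hypsubst; simp only: switch_simps; simp)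

definition flip :: "nat \<Rightarrow> (nat \<times> nat) set \<Rightarrow> (nat \<times> nat \<Rightarrow> nat) \<Rightarrow> nat \<times> nat \<Rightarrow> nat" where
  "flip k C c = (\<lambda>v. if v \<in> C then switch k (c v) else c v)"

text \<open>Boards are grouped by the positions of colour \<open>k\<close>; flips of components stay
  within a group.\<close>

definition fibre :: "nat \<Rightarrow> nat \<Rightarrow> (nat \<times> nat) set \<Rightarrow> (nat \<times> nat \<Rightarrow> nat) set" where
  "fibre n k X = {c \<in> chessboards n. off_colour n k c = X}"

lemma chessboard_PiE: "c \<in> chessboards n \<Longrightarrow> c \<in> squares n \<rightarrow>\<^sub>E {0, 1, 2}"
  unfolding chessboards_def by blast

lemma chessboard_colour: "c \<in> chessboards n \<Longrightarrow> v \<in> squares n \<Longrightarrow> c v \<in> {0, 1, 2}"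
  by (rule PiE_mem[OF chessboard_PiE])

lemma chessboardI:
  assumes c0: "c0 \<in> chessboards n" and PiE: "c \<in> squares n \<rightarrow>\<^sub>E {0, 1, 2}"
    and adj: "\<And>u v. u \<in> squares n \<Longrightarrow> v \<in> squares n \<Longrightarrow> adj u v \<Longrightarrow> c u \<noteq> c v"
    and eq: "\<And>v. v \<notin> interior n \<Longrightarrow> c v = c0 v"
  shows "c \<in> chessboards n"
proof -
  have "c (i, j) \<noteq> c (i, j+1)" if "i \<in> {1..n+1}" "j \<in> {1..n}" for i j
    using that by (intro adj) (auto simp: squares_def adj_right)
  moreover have "c (i, j) \<noteq> c (i+1, j)" if "i \<in> {1..n}" "j \<in> {1..n+1}" for i j
    using that by (intro adj) (auto simp: squares_def adj_down)
  moreover have "c (1, i) = c0 (1, i)" "c (i, 1) = c0 (i, 1)"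
    "c (n+1, i) = c0 (n+1, i)" "c (i, n+1) = c0 (i, n+1)" for i
    by (intro eq; simp add: interior_def)+
  ultimately show ?thesis using c0 PiE unfolding chessboards_def by simp
qed

text \<open>Within \<open>C\<close> distinct colours remain distinct, since \<open>switch k\<close>
  is injective on colours. A neighbour of \<open>C\<close> outside \<open>C\<close> has colour
  \<open>k\<close>, which no flipped square takes. As \<open>C\<close> is interior, the boundary is
  untouched.\<close>

lemma flip_fibre:
  assumes k: "k < 3" and c: "c \<in> fibre n k X" and C: "C \<in> components X" "C \<subseteq> interior n"
  shows "flip k C c \<in> fibre n k X"
proof -
  note k = less_3_cases[OF k]
  have cb: "c \<in> chessboards n" and X: "X = off_colour n k c" using c by (auto simp: fibre_def)
  have CX: "C \<subseteq> X" using C(1) by (rule component_subset)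
  then have sq: "C \<subseteq> squares n" unfolding X off_colour_def by blast
  note col = chessboard_colour[OF cb]
  have iff: "flip k C c v = k \<longleftrightarrow> c v = k" if "v \<in> squares n" for v
    using switch_eq_iff[OF k col[OF that]] by (simp add: flip_def)
  have "flip k C c \<in> chessboards n"
  proof (rule chessboardI[OF cb])
    show "flip k C c \<in> squares n \<rightarrow>\<^sub>E {0, 1, 2}"
    proof (rule PiE_I)
      show "flip k C c v \<in> {0, 1, 2}" if "v \<in> squares n" for v
        using col[OF that] switch_less unfolding flip_def by simp
      show "flip k C c v = undefined" if "v \<notin> squares n" for v
        using that sq PiE_arb[OF chessboard_PiE[OF cb] that] by (auto simp: flip_def)
    qed
    show "flip k C c u \<noteq> flip k C c v" if uv: "u \<in> squares n" "v \<in> squares n" "adj u v" for u v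
    proof -
      have ne: "c u \<noteq> c v" by (rule chessboard_adj[OF cb uv])
      have out: "c b = k" if "a \<in> C" "b \<in> squares n" "b \<notin> C" "adj a b" for a b
        using component_closed[OF C(1) that(1) _ that(4)] that unfolding X off_colour_def by blast
      have inn: "c a \<noteq> k" if "a \<in> C" for a
        using that CX unfolding X off_colour_def by blast
      consider "u \<in> C" "v \<in> C" | "u \<notin> C" "v \<notin> C" | "u \<in> C" "v \<notin> C" | "u \<notin> C" "v \<in> C" by blast
      then show ?thesis
      proof cases
        case 1
        then show ?thesis
          using ne switch_switch[OF k col[OF uv(1)]] switch_switch[OF k col[OF uv(2)]]
          unfolding flip_def by auto
      next
        case 3
        then have "flip k C c v = k" using out uv by (simp add: flip_def)
        with iff[OF uv(1)] inn[of u] 3 show ?thesis by auto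
      next
        case 4
        then have "flip k C c u = k" using out uv adj_sym by (simp add: flip_def)
        with iff[OF uv(2)] inn[of v] 4 show ?thesis by auto
      qed (use ne in \<open>simp add: flip_def\<close>)
    qed
    show "flip k C c v = c v" if "v \<notin> interior n" for v
      using that C(2) by (auto simp: flip_def)
  qed
  moreover have "off_colour n k (flip k C c) = X"
    using iff unfolding X off_colour_def by blast
  ultimately show ?thesis by (simp add: fibre_def)
qed

lemma flip_flip:
  assumes "k < 3" "c \<in> fibre n k X" "C \<in> components X"
  shows "flip k C (flip k C c) = c"
proof
  fix v
  have "v \<in> squares n" if "v \<in> C"
    using that component_subset[OF assms(3)] assms(2) by (auto simp: fibre_def off_colour_def)
  with assms show "flip k C (flip k C c) v = c v"
    using switch_switch[OF less_3_cases[OF assms(1)] chessboard_colour[of c n v]]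
    by (auto simp: flip_def fibre_def)
qed

definition average :: "nat \<Rightarrow> (nat \<Rightarrow> complex) \<Rightarrow> (nat \<times> nat \<Rightarrow> nat) \<Rightarrow> (nat \<times> nat) set \<Rightarrow> complex" where
  "average k w c C = ((\<Prod>v\<in>C. w (c v)) + (\<Prod>v\<in>C. w (switch k (c v)))) / 2"

text \<open>
  Each flip of a component permutes the fibre, so the sum does not change if the weight of the
  component is averaged over the two states of the component.
\<close>

lemma sum_fibre_average:
  assumes "k < 3" "finite F" "F \<subseteq> {C \<in> components X. C \<subseteq> interior n}"
  shows "(\<Sum>c\<in>fibre n k X. \<Prod>v\<in>squares n. w (c v)) =
    (\<Sum>c\<in>fibre n k X. (\<Prod>C\<in>F. average k w c C) * (\<Prod>v\<in>squares n - \<Union>F. w (c v)))"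
  using assms(2,3)
proof (induction F)
  case (insert D F)
  have D: "D \<in> components X" "D \<subseteq> interior n" using insert.prems by auto
  have F: "F \<subseteq> components X" using insert.prems by auto
  define R where "R = squares n - \<Union>(insert D F)"
  have disj: "C \<inter> D = {}" if "C \<in> F" for C
    using components_disjoint[of C X D] that F D(1) insert.hyps(2) by blast
  have "D \<subseteq> squares n" using D(2) by (auto simp: interior_def squares_def)
  then have split: "squares n - \<Union>F = D \<union> R" "D \<inter> R = {}" "finite D" "finite R"
    using disj finite_subset[of _ "squares n"] by (auto simp: R_def squares_def)
  define P where "P c = (\<Prod>C\<in>F. average k w c C) * (\<Prod>v\<in>R. w (c v))" for c
  define Q where "Q c = (\<Prod>C\<in>F. average k w c C) * (\<Prod>v\<in>squares n - \<Union>F. w (c v))" for c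
  have Q: "Q c = P c * (\<Prod>v\<in>D. w (c v))" for c
    unfolding P_def Q_def split(1) using split by (simp add: prod.union_disjoint)
  have P_flip: "P (flip k D c) = P c" for c
  proof -
    have "average k w (flip k D c) C = average k w c C" if "C \<in> F" for C
    proof -
      have "flip k D c v = c v" if "v \<in> C" for v
        using that disj[OF \<open>C \<in> F\<close>] by (auto simp: flip_def)
      then show ?thesis unfolding average_def by (simp cong: prod.cong)
    qed
    moreover have "w (flip k D c v) = w (c v)" if "v \<in> R" for v
      using that split(2) by (auto simp: flip_def)
    ultimately show ?thesis unfolding P_def by (simp cong: prod.cong)
  qed
  have Q_flip: "Q (flip k D c) = P c * (\<Prod>v\<in>D. w (switch k (c v)))" for c
    unfolding Q P_flip by (simp add: flip_def cong: prod.cong)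
  \<comment> \<open>Flipping \<open>D\<close> is an involution of the fibre, so \<open>Q\<close> may
    be replaced by the mean of \<open>Q\<close> and its flipped version. The factor \<open>P\<close>
    does not notice the flip, and the mean over \<open>D\<close> is the new factor.\<close>
  have "sum Q (fibre n k X) = (\<Sum>c\<in>fibre n k X. Q (flip k D c))"
    using flip_fibre[OF assms(1) _ D] flip_flip[OF assms(1) _ D(1)]
    by (intro sum.reindex_bij_witness[of _ "flip k D" "flip k D"]) auto
  then have "sum Q (fibre n k X) = (\<Sum>c\<in>fibre n k X. (Q c + Q (flip k D c)) / 2)"
    by (simp add: sum.distrib flip: sum_divide_distrib)
  also have "\<dots> = (\<Sum>c\<in>fibre n k X. average k w c D * P c)"
    unfolding Q_flip unfolding Q average_def by (simp add: field_simps)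
  also have "\<dots> = (\<Sum>c\<in>fibre n k X. (\<Prod>C\<in>insert D F. average k w c C) * (\<Prod>v\<in>R. w (c v)))"
    using insert.hyps by (simp add: P_def mult.assoc)
  finally show ?case using insert.IH insert.prems by (simp add: Q_def R_def)
qed simp

text \<open>The exponents \<open>a\<close> and \<open>b\<close> count the squares on which
  \<open>c\<close> takes the values \<open>p\<close> and \<open>q\<close>. They are chosen before
  \<open>w\<close>, because the weights will vary with a parameter.\<close>

lemma prod_switch:
  assumes "finite A" "\<And>v. v \<in> A \<Longrightarrow> (c v = p \<and> c' v = q) \<or> (c v = q \<and> c' v = p)"
  shows "\<exists>a b. a + b = card A \<and> (\<forall>w :: nat \<Rightarrow> complex.
    (\<Prod>v\<in>A. w (c v)) = w p ^ a * w q ^ b \<and> (\<Prod>v\<in>A. w (c' v)) = w q ^ a * w p ^ b)"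
  using assms
proof (induction A)
  case (insert u A)
  then obtain a b where ab: "a + b = card A" "\<And>w :: nat \<Rightarrow> complex. (\<Prod>v\<in>A. w (c v)) = w p ^ a * w q ^ b"
    "\<And>w :: nat \<Rightarrow> complex. (\<Prod>v\<in>A. w (c' v)) = w q ^ a * w p ^ b"
    by blast
  from insert.prems[of u] consider "c u = p" "c' u = q" | "c u = q" "c' u = p" by blast
  then show ?case
  proof cases
    case 1
    with ab insert.hyps show ?thesis by (intro exI[of _ "Suc a"] exI[of _ b]) (simp add: mult_ac)
  next
    case 2
    with ab insert.hyps show ?thesis by (intro exI[of _ a] exI[of _ "Suc b"]) (simp add: mult_ac)
  qed
qed (intro exI[of _ 0], simp)

lemma switch_other:
  assumes "k \<in> {0, 1, 2}" "a \<in> {0, 1, 2}" "a \<noteq> k"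
  shows "(a = (k + 1) mod 3 \<and> switch k a = (k + 2) mod 3) \<or> (a = (k + 2) mod 3 \<and> switch k a = (k + 1) mod 3)"
  using assms by (elim insertE emptyE; hypsubst) (simp_all only: switch_simps, simp_all)

text \<open>The form of \<open>Z3C\<close> with the weights given as a function of the colour, so
  that colours can be computed modulo 3.\<close>

definition partition_sum :: "nat \<Rightarrow> (nat \<Rightarrow> complex) \<Rightarrow> complex" where
  "partition_sum n w = (\<Sum>c\<in>chessboards n. \<Prod>v\<in>squares n. w (c v))"

text \<open>By \<open>prod_switch\<close> the average is half of a symmetric monomial of degree
  \<open>card C\<close> in the weights of the two colours other than \<open>k\<close>.\<close>

lemma order_ge_average:
  assumes k: "k < 3" and c: "c \<in> fibre n k X" and C: "C \<in> components X"
    and W: "order_ge (W ((k + 1) mod 3)) 1" "order_ge (W ((k + 2) mod 3)) 1"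
      "order_ge (\<lambda>z. W ((k + 1) mod 3) z + W ((k + 2) mod 3) z) 2"
  shows "order_ge (\<lambda>z. average k (\<lambda>a. W a z) c C) (int (card C) + of_bool (odd (card C)))"
proof -
  let ?p = "(k + 1) mod 3" and ?q = "(k + 2) mod 3"
  have cb: "c \<in> chessboards n" and X: "X = off_colour n k c" using c by (auto simp: fibre_def)
  have "C \<subseteq> off_colour n k c" using C X component_subset by blast
  then have CX: "v \<in> squares n" "c v \<noteq> k" if "v \<in> C" for v
    using that by (auto simp: off_colour_def)
  have "finite C" using CX(1) by (intro finite_subset[of C "squares n"]) (auto simp: squares_def)
  moreover have "(c v = ?p \<and> switch k (c v) = ?q) \<or> (c v = ?q \<and> switch k (c v) = ?p)" if "v \<in> C" for v
    by (rule switch_other[OF less_3_cases[OF k] chessboard_colour[OF cb CX(1)[OF that]] CX(2)[OF that]])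
  ultimately obtain a b where ab: "a + b = card C"
    "\<And>w :: nat \<Rightarrow> complex. (\<Prod>v\<in>C. w (c v)) = w ?p ^ a * w ?q ^ b"
    "\<And>w :: nat \<Rightarrow> complex. (\<Prod>v\<in>C. w (switch k (c v))) = w ?q ^ a * w ?p ^ b"
    using prod_switch[of C c ?p "\<lambda>v. switch k (c v)" ?q] by blast
  have "order_ge (\<lambda>z. (1 / 2) * (W ?p z ^ a * W ?q z ^ b + W ?q z ^ a * W ?p z ^ b))
      (int (card C) + of_bool (odd (card C)))"
    unfolding ab(1)[symmetric] by (intro order_ge_cmult order_ge_symmetric_monomial W)
  moreover have "average k (\<lambda>a. W a z) c C =
      (1 / 2) * (W ?p z ^ a * W ?q z ^ b + W ?q z ^ a * W ?p z ^ b)" for z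
    unfolding average_def ab(2)[of "\<lambda>a. W a z"] ab(3)[of "\<lambda>a. W a z"] by simp
  ultimately show ?thesis by (simp only:)
qed

text \<open>In each fibre all interior components are averaged at once. The orders of the factors
  then add up to minus the quantity bounded in \<open>off_colour_bound\<close>.\<close>

lemma order_ge_partition_sum:
  assumes k: "k < 3" and Wk: "order_ge (W k) (- 2)"
    and W: "order_ge (W ((k + 1) mod 3)) 1" "order_ge (W ((k + 2) mod 3)) 1"
      "order_ge (\<lambda>z. W ((k + 1) mod 3) z + W ((k + 2) mod 3) z) 2"
  shows "order_ge (\<lambda>z. partition_sum n (\<lambda>a. W a z)) (- pole_order n k)"
proof -
  have fin: "finite (squares n)" by (simp add: squares_def)
  have "order_ge (\<lambda>z. (\<Prod>C | C \<in> components X \<and> C \<subseteq> interior n. average k (\<lambda>a. W a z) c C) *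
      (\<Prod>v\<in>squares n - \<Union>{C \<in> components X. C \<subseteq> interior n}. W (c v) z)) (- pole_order n k)"
    if c: "c \<in> fibre n k X" for c X
  proof -
    have cb: "c \<in> chessboards n" and X: "X = off_colour n k c" using c by (auto simp: fibre_def)
    have Xsq: "X \<subseteq> squares n" unfolding X off_colour_def by blast
    then have finX: "finite X" using fin by (rule finite_subset)
    let ?F = "{C \<in> components X. C \<subseteq> interior n}"
    let ?g = "\<lambda>v. if c v = k then - 2 else 1 :: int"
    have F: "\<Union>?F \<subseteq> X" using component_subset by blast
    have "order_ge (W a) (if a = k then - 2 else 1)" if "a \<in> {0, 1, 2}" for a
    proof (cases "a = k")
      case False
      with switch_other[OF less_3_cases[OF k] that] have "a = (k + 1) mod 3 \<or> a = (k + 2) mod 3" by blast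
      with W(1,2) False show ?thesis by metis
    qed (use Wk in simp)
    then have "order_ge (W (c v)) (?g v)" if "v \<in> squares n" for v
      using chessboard_colour[OF cb that] .
    then have "order_ge (\<lambda>z. (\<Prod>C\<in>?F. average k (\<lambda>a. W a z) c C) * (\<Prod>v\<in>squares n - \<Union>?F. W (c v) z))
        ((\<Sum>C\<in>?F. int (card C) + of_bool (odd (card C))) + (\<Sum>v\<in>squares n - \<Union>?F. ?g v))"
    proof (intro order_ge_mult order_ge_prod)
      show "order_ge (\<lambda>z. average k (\<lambda>a. W a z) c C) (int (card C) + of_bool (odd (card C)))" if "C \<in> ?F" for C
        using that by (intro order_ge_average[OF k c _ W]) blast
    qed blast
    \<comment> \<open>The squares in the averaged components have order 1 each, as \<open>?g\<close>
      also assigns them; so the total is the sum of \<open>?g\<close> over the board plus the number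
      of odd interior components.\<close>
    moreover have "- pole_order n k \<le>
        (\<Sum>C\<in>?F. int (card C) + of_bool (odd (card C))) + (\<Sum>v\<in>squares n - \<Union>?F. ?g v)"
    proof -
      have "sum ?g (\<Union>?F) = (sum \<circ> sum) ?g ?F"
      proof (rule sum.Union_disjoint)
        show "\<forall>A\<in>?F. finite A" using finite_subset[OF component_subset finX] by blast
        show "\<forall>A\<in>?F. \<forall>B\<in>?F. A \<noteq> B \<longrightarrow> A \<inter> B = {}"
          using components_disjoint[of _ X] by blast
      qed
      moreover have "sum ?g C = int (card C)" if "C \<in> ?F" for C
      proof -
        have "sum ?g C = (\<Sum>v\<in>C. 1)"
          using that F unfolding X off_colour_def by (intro sum.cong refl) auto
        then show ?thesis by simp
      qed
      ultimately have "(\<Sum>C\<in>?F. int (card C)) = sum ?g (\<Union>?F)" by simp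
      moreover have "sum ?g (squares n) = sum ?g (squares n - \<Union>?F) + sum ?g (\<Union>?F)"
        using F Xsq fin by (intro sum.subset_diff) auto
      moreover have "sum ?g (squares n) = sum ?g (squares n - X) + sum ?g X"
        using Xsq fin by (rule sum.subset_diff)
      moreover have "sum ?g (squares n - X) = (\<Sum>v\<in>squares n - X. - 2)"
        unfolding X off_colour_def by (intro sum.cong refl) auto
      moreover have "sum ?g X = (\<Sum>v\<in>X. 1)"
        unfolding X off_colour_def by (intro sum.cong refl) auto
      moreover have "(\<Sum>C\<in>?F. of_bool (odd (card C)) :: int) =
          int (card {C \<in> components X. C \<subseteq> interior n \<and> odd (card C)})"
      proof -
        have "{C \<in> components X. C \<subseteq> interior n \<and> odd (card C)} = ?F \<inter> {C. odd (card C)}" by blast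
        then show ?thesis using finite_components[OF finX] by simp
      qed
      ultimately show ?thesis
        using off_colour_bound[OF cb k, folded X] by (simp add: sum.distrib)
    qed
    ultimately show ?thesis by (rule order_ge_mono)
  qed
  then have "order_ge (\<lambda>z. \<Sum>X\<in>off_colour n k ` chessboards n. \<Sum>c\<in>fibre n k X.
      (\<Prod>C | C \<in> components X \<and> C \<subseteq> interior n. average k (\<lambda>a. W a z) c C) *
      (\<Prod>v\<in>squares n - \<Union>{C \<in> components X. C \<subseteq> interior n}. W (c v) z)) (- pole_order n k)"
    by (intro order_ge_sum)
  moreover have "partition_sum n (\<lambda>a. W a z) =
      (\<Sum>X\<in>off_colour n k ` chessboards n. \<Sum>c\<in>fibre n k X.
        (\<Prod>C | C \<in> components X \<and> C \<subseteq> interior n. average k (\<lambda>a. W a z) c C) *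
        (\<Prod>v\<in>squares n - \<Union>{C \<in> components X. C \<subseteq> interior n}. W (c v) z))" for z
  proof -
    have "partition_sum n (\<lambda>a. W a z) =
        (\<Sum>X\<in>off_colour n k ` chessboards n. \<Sum>c\<in>fibre n k X. \<Prod>v\<in>squares n. W (c v) z)"
      unfolding partition_sum_def fibre_def by (rule sum.image_gen[OF finite_chessboards])
    also have "\<dots> = (\<Sum>X\<in>off_colour n k ` chessboards n. \<Sum>c\<in>fibre n k X.
        (\<Prod>C | C \<in> components X \<and> C \<subseteq> interior n. average k (\<lambda>a. W a z) c C) *
        (\<Prod>v\<in>squares n - \<Union>{C \<in> components X. C \<subseteq> interior n}. W (c v) z))"
    proof (rule sum.cong[OF refl])
      fix X assume "X \<in> off_colour n k ` chessboards n"
      then have "finite X" using fin by (auto simp: off_colour_def)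
      then show "(\<Sum>c\<in>fibre n k X. \<Prod>v\<in>squares n. W (c v) z) = (\<Sum>c\<in>fibre n k X.
        (\<Prod>C | C \<in> components X \<and> C \<subseteq> interior n. average k (\<lambda>a. W a z) c C) *
        (\<Prod>v\<in>squares n - \<Union>{C \<in> components X. C \<subseteq> interior n}. W (c v) z))"
        using finite_components by (intro sum_fibre_average[OF k]) auto
    qed
    finally show ?thesis .
  qed
  ultimately show ?thesis by (simp only:)
qed

subsection \<open>Laurent expansions along a family of weights\<close>

text \<open>Negative exponents require control of the inverse; the two hypotheses say that
  \<open>f\<close> has order exactly \<open>m\<close>.\<close>

lemma order_ge_powi:
  assumes "order_ge f m" "order_ge (\<lambda>z. inverse (f z)) (- m)"
  shows "order_ge (\<lambda>z. f z powi j) (m * j)"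
proof (cases "0 \<le> j")
  case True
  have "order_ge (\<lambda>z. f z ^ nat j) (int (nat j) * m)" by (rule order_ge_power[OF assms(1)])
  with True show ?thesis by (simp add: power_int_def mult.commute)
next
  case False
  have "order_ge (\<lambda>z. inverse (f z) ^ nat (- j)) (int (nat (- j)) * - m)"
    by (rule order_ge_power[OF assms(2)])
  with False show ?thesis by (simp add: power_int_def mult.commute)
qed

lemma order_ge_const_pos:
  assumes "order_ge (\<lambda>_. a) 1"
  shows "a = 0"
proof (rule ccontr)
  assume "a \<noteq> 0"
  obtain K where K: "0 \<le> K" "\<And>z. 0 < z \<Longrightarrow> z \<le> 1 \<Longrightarrow> norm a \<le> K * z powi 1"
    using assms order_geE by metis
  \<comment> \<open>Small enough that \<open>(K + 1) * z\<close> is at most half of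
    \<open>norm a\<close>; using \<open>K + 1\<close> avoids division by zero.\<close>
  define z where "z = min 1 (norm a / (2 * (K + 1)))"
  have "0 < z" "z \<le> 1" using \<open>a \<noteq> 0\<close> K(1) by (simp_all add: z_def)
  with K(2) have "norm a \<le> K * z" by force
  also have "\<dots> \<le> (K + 1) * z" using \<open>0 < z\<close> by (simp add: distrib_right)
  also have "\<dots> \<le> (K + 1) * (norm a / (2 * (K + 1)))"
    using K(1) by (intro mult_left_mono) (auto simp: z_def)
  also have "\<dots> = norm a / 2" using K(1) by (simp add: field_simps)
  finally show False using \<open>a \<noteq> 0\<close> by simp
qed

lemma order_ge_cong:
  assumes "order_ge f m" "\<And>z. 0 < z \<Longrightarrow> z \<le> 1 \<Longrightarrow> f z = g z"
  shows "order_ge g m"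
  using assms unfolding order_ge_def by metis

text \<open>Since \<open>f\<close> has exact order \<open>r\<close>, distinct powers of
  \<open>f\<close> have distinct orders and cannot cancel. Dividing by the dominant power leaves its
  coefficient plus terms of order at least 1, while the bound \<open>m\<close> makes the whole of
  order at least 1, so the coefficient vanishes, a contradiction.\<close>

lemma laurent_coefficient_zero:
  assumes J: "finite J" "j \<in> J" and r: "r \<noteq> 0"
    and f: "order_ge f r" "order_ge (\<lambda>z. inverse (f z)) (- r)"
    and nz: "\<And>z. 0 < z \<Longrightarrow> z \<le> 1 \<Longrightarrow> f z \<noteq> 0"
    and sum: "order_ge (\<lambda>z. \<Sum>i\<in>J. a i * f z powi i) m" and "r * j < m"
  shows "a j = 0"
proof (rule ccontr)
  assume "a j \<noteq> 0"
  define S where "S = {i \<in> J. a i \<noteq> 0}"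
  have S: "finite S" "j \<in> S" using J \<open>a j \<noteq> 0\<close> by (auto simp: S_def)
  \<comment> \<open>Minimising \<open>r * i\<close> instead of \<open>i\<close> selects the dominant
    power for either sign of \<open>r\<close>.\<close>
  then obtain l where "is_arg_min (\<lambda>i. r * i) (\<lambda>i. i \<in> S) l"
    using ex_is_arg_min_if_finite[of S] by blast
  then have l: "l \<in> S" "\<And>i. i \<in> S \<Longrightarrow> r * l \<le> r * i" by (auto simp: is_arg_min_linorder)
  have "order_ge (\<lambda>z. f z powi (- l) * (\<Sum>i\<in>J. a i * f z powi i)) (r * - l + m)"
    by (rule order_ge_mult[OF order_ge_powi[OF f] sum])
  then have 1: "order_ge (\<lambda>z. f z powi (- l) * (\<Sum>i\<in>J. a i * f z powi i)) 1"
    by (rule order_ge_mono) (use l(2)[OF S(2)] \<open>r * j < m\<close> in simp)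
  have 2: "order_ge (\<lambda>z. \<Sum>i\<in>S - {l}. - a i * f z powi (i - l)) 1"
  proof (rule order_ge_sum)
    fix i assume i: "i \<in> S - {l}"
    have "order_ge (\<lambda>z. - a i * f z powi (i - l)) (r * (i - l))"
      by (intro order_ge_cmult order_ge_powi f)
    moreover have "r * l < r * i"
      using l(2)[of i] i r by (simp add: order_less_le)
    then have "1 \<le> r * (i - l)" by (simp add: right_diff_distrib)
    ultimately show "order_ge (\<lambda>z. - a i * f z powi (i - l)) 1" by (rule order_ge_mono)
  qed
  have "order_ge (\<lambda>_. a l) 1"
  proof (rule order_ge_cong[OF order_ge_add[OF 1 2]])
    fix z :: real assume z: "0 < z" "z \<le> 1"
    have "(\<Sum>i\<in>J. a i * f z powi i) = (\<Sum>i\<in>S. a i * f z powi i)"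
      using J(1) by (intro sum.mono_neutral_right) (auto simp: S_def)
    then have "f z powi (- l) * (\<Sum>i\<in>J. a i * f z powi i) = (\<Sum>i\<in>S. a i * f z powi (i - l))"
      using nz[OF z] by (simp add: sum_distrib_left power_int_diff power_int_minus divide_inverse mult_ac)
    also have "\<dots> = a l + (\<Sum>i\<in>S - {l}. a i * f z powi (i - l))"
      using S(1) l(1) by (simp add: sum.remove)
    finally show "f z powi (- l) * (\<Sum>i\<in>J. a i * f z powi i) +
        (\<Sum>i\<in>S - {l}. - a i * f z powi (i - l)) = a l"
      by (simp add: sum_negf)
  qed
  then have "a l = 0" by (rule order_ge_const_pos)
  with l(1) show False by (simp add: S_def)
qed

text \<open>From x^2 = (x + y) x - x y, a root larger than (M + 1) z would satisfy |x|^2 \<le> M z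
  |x| + z |x| < |x|^2.\<close>

lemma root_bound:
  fixes x y :: complex
  assumes "0 < z" "z \<le> 1" and M: "norm (x + y) \<le> M * z ^ 2" and xy: "x * y = of_real (z ^ 2)"
  shows "norm x \<le> (M + 1) * z"
proof (rule ccontr)
  assume "\<not> ?thesis"
  then have less: "(M + 1) * z < norm x" by simp
  have "0 \<le> M * z ^ 2" using norm_ge_zero M by (rule order_trans)
  then have "0 \<le> M" using assms(1) by (simp add: zero_le_mult_iff)
  have "z \<le> (M + 1) * z" using \<open>0 \<le> M\<close> assms(1) by (simp add: distrib_right)
  with less have zx: "z < norm x" by simp
  have "norm x * norm x = norm ((x + y) * x - x * y)"
    by (simp add: algebra_simps flip: norm_mult)
  also have "\<dots> \<le> norm (x + y) * norm x + z ^ 2"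
    unfolding xy by (rule order_trans[OF norm_triangle_ineq4]) (simp add: norm_mult norm_power)
  also have "\<dots> \<le> (M * z) * norm x + z * norm x"
  proof (intro add_mono mult_right_mono)
    have "M * z ^ 2 \<le> M * z"
      using \<open>0 \<le> M\<close> assms(1,2) by (intro mult_left_mono) (auto simp: power2_eq_square mult_left_le)
    with M show "norm (x + y) \<le> M * z" by simp
    show "z ^ 2 \<le> z * norm x" unfolding power2_eq_square using zx assms(1) by simp
  qed simp
  also have "\<dots> = ((M + 1) * z) * norm x" by (simp add: algebra_simps)
  also have "\<dots> < norm x * norm x" using less zx assms(1) by (intro mult_strict_right_mono) auto
  finally show False by simp
qed

text \<open>
  In the family below the colour of weight \<open>z\<^sup>-\<^sup>2\<close> has a pole, while
  the elementary symmetric polynomials are \<open>s\<close> and \<open>1\<close> for all \<open>z\<close>.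
\<close>

lemma weight_family:
  obtains x y :: "real \<Rightarrow> complex" where
    "\<And>z. 0 < z \<Longrightarrow> z \<le> 1 \<Longrightarrow> x z * y z = of_real z ^ 2"
    "\<And>z. 0 < z \<Longrightarrow> z \<le> 1 \<Longrightarrow> inverse (of_real z ^ 2) * (x z + y z) + x z * y z = s"
    "order_ge x 1" "order_ge y 1" "order_ge (\<lambda>z. x z + y z) 2"
    "order_ge (\<lambda>z. inverse (x z)) (- 1)" "order_ge (\<lambda>z. inverse (y z)) (- 1)"
proof -
  \<comment> \<open>The product of the roots is to be z^2, and the condition on \<open>s\<close>
    then forces their sum to be s z^2 - z^4. So \<open>x\<close> and \<open>y\<close> solve a
    quadratic equation, with \<open>d\<close> a square root of its discriminant.\<close>
  define q d :: "real \<Rightarrow> complex" where "q z = s * of_real z ^ 2 - of_real z ^ 4"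
    and "d z = csqrt (q z ^ 2 - 4 * of_real z ^ 2)" for z
  define x y where "x z = (q z + d z) / 2" and "y z = (q z - d z) / 2" for z
  have xy: "x z * y z = of_real z ^ 2" for z
  proof -
    have "x z * y z = (q z ^ 2 - d z ^ 2) / 4"
      by (simp add: x_def y_def power2_eq_square algebra_simps)
    then show ?thesis by (simp add: d_def)
  qed
  have sum: "x z + y z = q z" for z by (simp add: x_def y_def field_simps)
  define M where "M = norm s + 1"
  have q: "norm (q z) \<le> M * z ^ 2" if z: "0 < z" "z \<le> 1" for z
  proof -
    have "norm (q z) \<le> norm s * z ^ 2 + z ^ 4"
      unfolding q_def using z
      by (intro order_trans[OF norm_triangle_ineq4]) (simp add: norm_mult norm_power)
    moreover have "z ^ 4 \<le> z ^ 2" using z by (intro power_decreasing) auto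
    ultimately show ?thesis by (simp add: M_def distrib_right)
  qed
  have x: "norm (x z) \<le> (M + 1) * z" and y: "norm (y z) \<le> (M + 1) * z" if z: "0 < z" "z \<le> 1" for z
    using root_bound[OF z, of "x z" "y z" M] root_bound[OF z, of "y z" "x z" M] q[OF z]
    by (simp_all add: sum xy mult.commute[of "y z"] add.commute[of "y z"])
  have inv: "norm (inverse (x z)) \<le> (M + 1) * z powi - 1" "norm (inverse (y z)) \<le> (M + 1) * z powi - 1"
    if z: "0 < z" "z \<le> 1" for z
  proof -
    have "x z * y z \<noteq> 0" unfolding xy using z by simp
    then have "inverse (x z) = y z * inverse (of_real z ^ 2)" "inverse (y z) = x z * inverse (of_real z ^ 2)"
      unfolding xy[of z, symmetric] by simp_all
    moreover have "norm (w * inverse (of_real z ^ 2)) \<le> (M + 1) * z powi - 1"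
      if "norm w \<le> (M + 1) * z" for w :: complex
    proof -
      have "norm (w * inverse (of_real z ^ 2)) = norm w * inverse (z ^ 2)"
        by (simp add: norm_mult norm_inverse norm_power)
      also have "\<dots> \<le> (M + 1) * z * inverse (z ^ 2)"
        using that by (intro mult_right_mono) auto
      also have "\<dots> = (M + 1) * z powi - 1"
        using z by (simp add: power_int_minus power2_eq_square field_simps)
      finally show ?thesis .
    qed
    ultimately show "norm (inverse (x z)) \<le> (M + 1) * z powi - 1" "norm (inverse (y z)) \<le> (M + 1) * z powi - 1"
      using x[OF z] y[OF z] by simp_all
  qed
  show thesis
  proof (rule that)
    show "inverse (of_real z ^ 2) * (x z + y z) + x z * y z = s" if "0 < z" for z
      using that unfolding sum xy q_def by (simp add: field_simps power4_eq_xxxx power2_eq_square)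
    show "order_ge x 1" "order_ge y 1"
      unfolding order_ge_def using x y by (intro exI[of _ "M + 1"]; simp)+
    show "order_ge (\<lambda>z. inverse (x z)) (- 1)" "order_ge (\<lambda>z. inverse (y z)) (- 1)"
      unfolding order_ge_def using inv by (intro exI[of _ "M + 1"]; blast)+
    show "order_ge (\<lambda>z. x z + y z) 2"
      unfolding order_ge_def sum using q by (intro exI[of _ M]) simp
  qed (rule xy)
qed

subsection \<open>Homogeneous expressions in the elementary symmetric polynomials\<close>

text \<open>The exponent in {0, 1, 2} whose double is congruent to \<open>m\<close> modulo 3. With
  \<open>cofactor_exp m\<close>, where the division is exact, a monomial with these exponents in
  degrees 2 and 3 has total degree \<open>m\<close>.\<close>

definition residue_exp :: "int \<Rightarrow> nat" where
  "residue_exp m = nat (2 * m mod 3)"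

definition cofactor_exp :: "int \<Rightarrow> int" where
  "cofactor_exp m = (m - 2 * int (residue_exp m)) div 3"

text \<open>
  If \<open>a\<close> and \<open>b\<close> are the elementary symmetric polynomials of degree 2 and 3, then this is
  a general homogeneous expression of degree \<open>m\<close> in \<open>a\<close> and \<open>b\<close>, with negative powers of \<open>b\<close> allowed.
\<close>

definition weighted :: "int \<Rightarrow> complex poly \<Rightarrow> complex \<Rightarrow> complex \<Rightarrow> complex" where
  "weighted m p a b = a ^ residue_exp m * b powi cofactor_exp m * poly p (a ^ 3 / b ^ 2)"

lemma exp_add_3: "residue_exp (m + 3) = residue_exp m" "cofactor_exp (m + 3) = cofactor_exp m + 1"
proof -
  have "2 * (m + 3) mod 3 = (2 * m) mod (3 :: int)"
    using mod_mult_self2[of "2 * m" 3 2] by simp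
  then show r: "residue_exp (m + 3) = residue_exp m" by (simp add: residue_exp_def)
  have "m + 3 - x = (m - x) + 3 * 1" for x :: int by simp
  then show "cofactor_exp (m + 3) = cofactor_exp m + 1"
    unfolding cofactor_exp_def r by (simp only: div_mult_self2)
qed

lemma exp_cases:
  obtains i where "m = 3 * i" | i where "m = 3 * i + 1" | i where "m = 3 * i + (2 :: int)"
proof -
  have "m mod 3 = 0 \<or> m mod 3 = 1 \<or> m mod 3 = 2"
    using pos_mod_sign[of 3 m] pos_mod_bound[of 3 m] by linarith
  then have "m = 3 * (m div 3) \<or> m = 3 * (m div 3) + 1 \<or> m = 3 * (m div 3) + 2"
    using mult_div_mod_eq[of 3 m] by linarith
  then show thesis using that by blast
qed

lemma exp_values:
  "residue_exp (3 * i) = 0" "residue_exp (3 * i + 1) = 2" "residue_exp (3 * i + 2) = 1"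
  "cofactor_exp (3 * i) = i" "cofactor_exp (3 * i + 1) = i - 1" "cofactor_exp (3 * i + 2) = i"
proof -
  have "2 * (3 * i) mod 3 = 0" by simp
  moreover have "2 * (3 * i + 1) = 2 + (2 * i) * 3" "2 * (3 * i + 2) = 1 + (2 * i + 1) * 3" by simp_all
  ultimately show r: "residue_exp (3 * i) = 0" "residue_exp (3 * i + 1) = 2" "residue_exp (3 * i + 2) = 1"
    by (simp_all only: residue_exp_def mod_mult_self1) simp_all
  show "cofactor_exp (3 * i) = i" "cofactor_exp (3 * i + 1) = i - 1" "cofactor_exp (3 * i + 2) = i"
    unfolding cofactor_exp_def r by simp_all
qed

lemma weighted_times_b: "\<exists>q. \<forall>a b. b \<noteq> 0 \<longrightarrow> b * weighted m p a b = weighted (m + 3) q a b"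
  by (intro exI[of _ p]) (simp add: weighted_def exp_add_3 power_int_add)

text \<open>The exponent of \<open>a\<close> grows by one unless it is already 2. In that case a^3
  is replaced by b^2 times the argument of the polynomial, which is why \<open>pCons 0 p\<close>
  occurs.\<close>

lemma weighted_times_a: "\<exists>q. \<forall>a b. b \<noteq> 0 \<longrightarrow> a * weighted m p a b = weighted (m + 2) q a b"
proof (cases m rule: exp_cases)
  case (1 i)
  then show ?thesis by (intro exI[of _ p]) (simp add: weighted_def exp_values)
next
  case (2 i)
  then have m: "m + 2 = 3 * (i + 1)" by simp
  have "weighted m p a b = a ^ 2 * b powi (i - 1) * poly p (a ^ 3 / b ^ 2)" for a b
    unfolding weighted_def 2 exp_values ..
  moreover have "weighted (m + 2) q a b = b powi (i + 1) * poly q (a ^ 3 / b ^ 2)" for q a b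
    unfolding weighted_def m exp_values by simp
  moreover have "a * (a ^ 2 * b powi (i - 1) * c) = b powi (i + 1) * ((a ^ 3 / b ^ 2) * c)"
    if "b \<noteq> 0" for a b c :: complex
    using that by (simp add: power_int_add power_int_diff field_simps power2_eq_square power3_eq_cube)
  ultimately show ?thesis by (intro exI[of _ "pCons 0 p"]) simp
next
  case (3 i)
  then have m: "m + 2 = 3 * (i + 1) + 1" by simp
  have "weighted m p a b = a * b powi i * poly p (a ^ 3 / b ^ 2)" for a b
    unfolding weighted_def 3 exp_values by simp
  moreover have "weighted (m + 2) q a b = a ^ 2 * b powi i * poly q (a ^ 3 / b ^ 2)" for q a b
    unfolding weighted_def m exp_values by simp
  ultimately show ?thesis by (intro exI[of _ p]) (simp add: power2_eq_square)
qed

lemma weighted_add: "weighted m (p + q) a b = weighted m p a b + weighted m q a b"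
  by (simp add: weighted_def algebra_simps)

lemma weighted_smult: "weighted m (smult c p) a b = c * weighted m p a b"
  by (simp add: weighted_def)

lemma weighted_zero: "weighted m 0 a b = 0"
  by (simp add: weighted_def)

text \<open>Homogeneous Laurent polynomials of degree \<open>N\<close> in \<open>t\<close>, with
  coefficients that depend only on the elementary symmetric polynomials of \<open>t\<close>,
  \<open>x\<close>, \<open>y\<close>. Such functions are symmetric in \<open>x\<close> and
  \<open>y\<close>.\<close>

definition graded :: "int \<Rightarrow> (complex \<Rightarrow> complex \<Rightarrow> complex \<Rightarrow> complex) \<Rightarrow> bool" where
  "graded N f \<longleftrightarrow> (\<exists>J p. finite J \<and> (\<forall>t x y. t \<noteq> 0 \<longrightarrow> x \<noteq> 0 \<longrightarrow> y \<noteq> 0 \<longrightarrow>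
    f t x y = (\<Sum>j\<in>J. t powi j * weighted (N - j) (p j) (t * x + t * y + x * y) (t * x * y))))"

lemma graded_cong:
  assumes "graded N f" "\<And>t x y. t \<noteq> 0 \<Longrightarrow> x \<noteq> 0 \<Longrightarrow> y \<noteq> 0 \<Longrightarrow> f t x y = g t x y"
  shows "graded N g"
proof -
  obtain J p where "finite J" "\<And>t x y. t \<noteq> 0 \<Longrightarrow> x \<noteq> 0 \<Longrightarrow> y \<noteq> 0 \<Longrightarrow>
      f t x y = (\<Sum>j\<in>J. t powi j * weighted (N - j) (p j) (t * x + t * y + x * y) (t * x * y))"
    using assms(1) unfolding graded_def by blast
  then show ?thesis unfolding graded_def
    by (intro exI[of _ J] exI[of _ p]) (simp flip: assms(2))
qed

lemma graded_add:
  assumes "graded N f" "graded N g"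
  shows "graded N (\<lambda>t x y. f t x y + g t x y)"
proof -
  obtain J p where J: "finite J" "\<And>t x y. t \<noteq> 0 \<Longrightarrow> x \<noteq> 0 \<Longrightarrow> y \<noteq> 0 \<Longrightarrow>
      f t x y = (\<Sum>j\<in>J. t powi j * weighted (N - j) (p j) (t * x + t * y + x * y) (t * x * y))"
    using assms(1) unfolding graded_def by blast
  obtain K q where K: "finite K" "\<And>t x y. t \<noteq> 0 \<Longrightarrow> x \<noteq> 0 \<Longrightarrow> y \<noteq> 0 \<Longrightarrow>
      g t x y = (\<Sum>j\<in>K. t powi j * weighted (N - j) (q j) (t * x + t * y + x * y) (t * x * y))"
    using assms(2) unfolding graded_def by blast
  define p' where "p' j = (if j \<in> J then p j else 0)" for j
  define q' where "q' j = (if j \<in> K then q j else 0)" for j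
  have "f t x y + g t x y = (\<Sum>j\<in>J \<union> K. t powi j * weighted (N - j) (p' j + q' j) (t * x + t * y + x * y) (t * x * y))"
    if "t \<noteq> 0" "x \<noteq> 0" "y \<noteq> 0" for t x y
  proof -
    have "f t x y = (\<Sum>j\<in>J \<union> K. t powi j * weighted (N - j) (p' j) (t * x + t * y + x * y) (t * x * y))"
      unfolding J(2)[OF that] using J(1) K(1)
      by (intro sum.mono_neutral_cong_left) (auto simp: p'_def weighted_zero)
    moreover have "g t x y = (\<Sum>j\<in>J \<union> K. t powi j * weighted (N - j) (q' j) (t * x + t * y + x * y) (t * x * y))"
      unfolding K(2)[OF that] using J(1) K(1)
      by (intro sum.mono_neutral_cong_left) (auto simp: q'_def weighted_zero)
    ultimately show ?thesis by (simp add: weighted_add distrib_left sum.distrib)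
  qed
  with J(1) K(1) show ?thesis unfolding graded_def
    by (intro exI[of _ "J \<union> K"] exI[of _ "\<lambda>j. p' j + q' j"]) simp
qed

text \<open>The factor \<open>h\<close> stands for a homogeneous expression of degree
  \<open>k\<close> in the elementary symmetric polynomials; it changes the coefficients, and the
  power of \<open>t\<close> moves the index by \<open>l\<close>.\<close>

lemma graded_shift:
  assumes "graded N f"
    and h: "\<And>m p. \<exists>q. \<forall>a b. b \<noteq> 0 \<longrightarrow> h a b * weighted m p a b = weighted (m + k) q a b"
  shows "graded (N + k + l) (\<lambda>t x y. t powi l * h (t * x + t * y + x * y) (t * x * y) * f t x y)"
proof -
  obtain J p where J: "finite J" "\<And>t x y. t \<noteq> 0 \<Longrightarrow> x \<noteq> 0 \<Longrightarrow> y \<noteq> 0 \<Longrightarrow>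
      f t x y = (\<Sum>j\<in>J. t powi j * weighted (N - j) (p j) (t * x + t * y + x * y) (t * x * y))"
    using assms(1) unfolding graded_def by blast
  have "\<forall>j. \<exists>q. \<forall>a b. b \<noteq> 0 \<longrightarrow> h a b * weighted (N - j) (p j) a b = weighted (N - j + k) q a b"
    using h by blast
  then obtain q where q: "\<And>j a b. b \<noteq> 0 \<Longrightarrow> h a b * weighted (N - j) (p j) a b = weighted (N - j + k) (q j) a b"
    by metis
  have "t powi l * h (t * x + t * y + x * y) (t * x * y) * f t x y =
      (\<Sum>i\<in>(\<lambda>j. j + l) ` J. t powi i * weighted (N + k + l - i) (q (i - l)) (t * x + t * y + x * y) (t * x * y))"
    if nz: "t \<noteq> 0" "x \<noteq> 0" "y \<noteq> 0" for t x y
  proof -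
    let ?a = "t * x + t * y + x * y" and ?b = "t * x * y"
    have b: "?b \<noteq> 0" using nz by simp
    have "t powi l * h ?a ?b * f t x y = (\<Sum>j\<in>J. t powi (j + l) * (h ?a ?b * weighted (N - j) (p j) ?a ?b))"
      unfolding J(2)[OF nz] sum_distrib_left using nz by (simp add: power_int_add mult_ac)
    also have "\<dots> = (\<Sum>j\<in>J. t powi (j + l) * weighted (N - j + k) (q j) ?a ?b)"
      unfolding q[OF b] ..
    also have "\<dots> = (\<Sum>i\<in>(\<lambda>j. j + l) ` J. t powi i * weighted (N + k + l - i) (q (i - l)) ?a ?b)"
      by (subst sum.reindex) (auto simp: inj_on_def algebra_simps intro!: sum.cong)
    finally show ?thesis .
  qed
  with J(1) show ?thesis unfolding graded_def
    by (intro exI[of _ "(\<lambda>j. j + l) ` J"] exI[of _ "\<lambda>i. q (i - l)"]) simp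
qed

lemma graded_cmult:
  assumes "graded N f"
  shows "graded N (\<lambda>t x y. c * f t x y)"
  using graded_shift[OF assms, of "\<lambda>_ _. c" 0 0] by (auto simp flip: weighted_smult)

lemma graded_times_t:
  assumes "graded N f"
  shows "graded (N + 1) (\<lambda>t x y. t * f t x y)"
  using graded_shift[OF assms, of "\<lambda>_ _. 1" 0 1] by auto

text \<open>Here x y is e3 / t.\<close>

lemma graded_times_xy:
  assumes "graded N f"
  shows "graded (N + 2) (\<lambda>t x y. (x * y) * f t x y)"
proof (rule graded_cong)
  have shift: "N + 3 + - 1 = N + 2" by simp
  show "graded (N + 2) (\<lambda>t x y. t powi - 1 * (t * x * y) * f t x y)"
    using graded_shift[OF assms weighted_times_b, of "- 1"] by (simp only: shift)
qed (simp add: power_int_minus)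

text \<open>Here x + y is e2 / t - e3 / t^2.\<close>

lemma graded_times_sum:
  assumes "graded N f"
  shows "graded (N + 1) (\<lambda>t x y. (x + y) * f t x y)"
proof (rule graded_cong)
  have shift: "N + 2 + - 1 = N + 1" "N + 3 + - 2 = N + 1" by simp_all
  have 1: "graded (N + 1) (\<lambda>t x y. t powi - 1 * (t * x + t * y + x * y) * f t x y)"
    using graded_shift[OF assms weighted_times_a, of "- 1"] by (simp only: shift)
  have "graded (N + 1) (\<lambda>t x y. t powi - 2 * (t * x * y) * f t x y)"
    using graded_shift[OF assms weighted_times_b, of "- 2"] by (simp only: shift)
  then have 2: "graded (N + 1) (\<lambda>t x y. - 1 * (t powi - 2 * (t * x * y) * f t x y))"
    by (rule graded_cmult)
  show "graded (N + 1) (\<lambda>t x y. t powi - 1 * (t * x + t * y + x * y) * f t x y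
      + - 1 * (t powi - 2 * (t * x * y) * f t x y))"
    by (rule graded_add[OF 1 2])
  fix t x y :: complex
  assume "t \<noteq> 0"
  then have "(t powi - 1 * (t * x + t * y + x * y) - t powi - 2 * (t * x * y)) = x + y"
    by (simp add: power_int_minus divide_simps power2_eq_square) (simp add: algebra_simps)
  then have "(t powi - 1 * (t * x + t * y + x * y) - t powi - 2 * (t * x * y)) * f t x y = (x + y) * f t x y"
    by (rule arg_cong)
  then show "t powi - 1 * (t * x + t * y + x * y) * f t x y
      + - 1 * (t powi - 2 * (t * x * y) * f t x y) = (x + y) * f t x y"
    by (simp only: distrib_right mult_minus1 diff_conv_add_uminus minus_mult_left)
qed

lemma graded_one: "graded 0 (\<lambda>_ _ _. 1)"
  unfolding graded_def
  by (intro exI[of _ "{0}"] exI[of _ "\<lambda>_. 1"])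
    (simp add: weighted_def exp_values[of 0, simplified])

lemma graded_power_sum: "graded (int m) (\<lambda>_ x y. x ^ m + y ^ m)"
proof (induction m rule: induct_nat_012)
  case 0
  show ?case using graded_cmult[OF graded_one, of 2] by simp
next
  case 1
  show ?case using graded_times_sum[OF graded_one] by simp
next
  case (ge2 m)
  have 1: "graded (int (Suc (Suc m))) (\<lambda>_ x y. (x + y) * (x ^ Suc m + y ^ Suc m))"
    using graded_times_sum[OF ge2(2)] by (simp add: algebra_simps)
  have "graded (int (Suc (Suc m))) (\<lambda>_ x y. (x * y) * (x ^ m + y ^ m))"
    using graded_times_xy[OF ge2(1)] by (simp add: algebra_simps)
  then have 2: "graded (int (Suc (Suc m))) (\<lambda>_ x y. - 1 * ((x * y) * (x ^ m + y ^ m)))"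
    by (rule graded_cmult)
  show ?case by (rule graded_cong[OF graded_add[OF 1 2]]) (simp add: algebra_simps)
qed

lemma graded_xy_power:
  assumes "graded N f"
  shows "graded (N + 2 * int a) (\<lambda>t x y. (x * y) ^ a * f t x y)"
proof (induction a)
  case (Suc a)
  show ?case using graded_times_xy[OF Suc] by (simp add: algebra_simps)
qed (use assms in simp)

lemma graded_t_power:
  assumes "graded N f"
  shows "graded (N + int a) (\<lambda>t x y. t ^ a * f t x y)"
proof (induction a)
  case (Suc a)
  show ?case using graded_times_t[OF Suc] by (simp add: algebra_simps)
qed (use assms in simp)

lemma graded_symmetric_monomial: "graded (int (a + b)) (\<lambda>_ x y. x ^ a * y ^ b + y ^ a * x ^ b)"
proof -
  have *: "graded (int (a + (a + d))) (\<lambda>_ x y. x ^ a * y ^ (a + d) + y ^ a * x ^ (a + d))" for a d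
  proof (rule graded_cong)
    show "graded (int (a + (a + d))) (\<lambda>_ x y. (x * y) ^ a * (x ^ d + y ^ d))"
      using graded_xy_power[OF graded_power_sum[of d], of a] by (simp add: algebra_simps)
  qed (simp add: power_add power_mult_distrib algebra_simps)
  show ?thesis
  proof (cases "a \<le> b")
    case True
    then show ?thesis using *[of a "b - a"] by simp
  next
    case False
    then show ?thesis using *[of b "a - b"] by (simp add: mult.commute add.commute)
  qed
qed

lemma graded_sum:
  assumes "finite S" "\<And>s. s \<in> S \<Longrightarrow> graded N (f s)"
  shows "graded N (\<lambda>t x y. \<Sum>s\<in>S. f s t x y)"
  using assms
proof (induction S)
  case empty
  show ?case unfolding graded_def by (intro exI[of _ "{}"]) simp
next
  case (insert s S)
  then show ?case using graded_add[of N "f s"] by simp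
qed

subsection \<open>Reflection of the board\<close>

definition reflect :: "nat \<Rightarrow> nat \<times> nat \<Rightarrow> nat \<times> nat" where
  "reflect n v = (fst v, n + 2 - snd v)"

lemma reflect_squares: "v \<in> squares n \<Longrightarrow> reflect n v \<in> squares n"
  by (auto simp: reflect_def squares_def)

lemma reflect_reflect: "v \<in> squares n \<Longrightarrow> reflect n (reflect n v) = v"
  by (auto simp: reflect_def squares_def)

text \<open>
  Reflecting a board reverses the direction in which the colours increase; replacing
  each colour \<open>a\<close> by \<open>n - a\<close> restores the boundary condition.
\<close>

definition mirror :: "nat \<Rightarrow> (nat \<times> nat \<Rightarrow> nat) \<Rightarrow> nat \<times> nat \<Rightarrow> nat" where
  "mirror n c = (\<lambda>v. if v \<in> squares n then switch (2 * n mod 3) (c (reflect n v)) else undefined)"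

lemma two_mod_three: "(2 * n) mod 3 \<in> {0, 1, 2 :: nat}"
  by (rule less_3_cases) simp

text \<open>With \<open>k\<close> congruent to 2n, \<open>switch k a\<close> is congruent to -2n -
  a, that is n - a, modulo 3; and n - (n + 1 - i) is i - 1.\<close>

lemma switch_boundary:
  assumes "i \<in> {1..Suc n}"
  shows "switch (2 * n mod 3) ((Suc n - i) mod 3) = (i - 1) mod 3"
proof -
  obtain l m where "n = l + m" "i = Suc l"
    using assms by (intro that[of "i - 1" "Suc n - i"]) auto
  moreover have "(2 * ((2 * (l + m)) mod 3) + 2 * (m mod 3)) mod 3 = (2 * (2 * (l + m)) + 2 * m) mod 3"
    by (intro mod_add_cong mod_mult_right_eq)
  moreover have "2 * (2 * (l + m)) + 2 * m = l + 3 * (l + 2 * m)" by simp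
  moreover have "(l + 3 * (l + 2 * m)) mod 3 = l mod 3" by (rule mod_mult_self2)
  moreover have "Suc (l + m) - Suc l = m" "Suc l - 1 = l" by simp_all
  ultimately show ?thesis unfolding switch_def by (simp only:)
qed

lemma mirror_chessboard:
  assumes c: "c \<in> chessboards n"
  shows "mirror n c \<in> chessboards n"
proof -
  let ?d = "2 * n mod 3"
  note col = chessboard_colour[OF c]
  have "mirror n c \<in> squares n \<rightarrow>\<^sub>E {0, 1, 2}"
    using switch_less by (intro PiE_I) (simp_all add: mirror_def)
  moreover have ne: "mirror n c u \<noteq> mirror n c v"
    if "u \<in> squares n" "v \<in> squares n" "adj (reflect n u) (reflect n v)" for u v
  proof -
    have uv: "reflect n u \<in> squares n" "reflect n v \<in> squares n"
      using that reflect_squares by blast+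
    then have "c (reflect n u) \<noteq> c (reflect n v)" using c that(3) by (intro chessboard_adj)
    then show ?thesis
      using that(1,2) switch_switch[OF two_mod_three[of n] col[OF uv(1)]]
        switch_switch[OF two_mod_three[of n] col[OF uv(2)]]
      unfolding mirror_def by auto
  qed
  have "mirror n c (i, j) \<noteq> mirror n c (i, j+1)" if "i \<in> {1..n+1}" "j \<in> {1..n}" for i j
  proof (rule ne)
    have "n + 2 - j = Suc (n + 2 - (j + 1))" using that by auto
    then show "adj (reflect n (i, j)) (reflect n (i, j + 1))"
      unfolding reflect_def fst_conv snd_conv by (metis adj_right adj_sym)
  qed (use that in \<open>auto simp: squares_def\<close>)
  moreover have "mirror n c (i, j) \<noteq> mirror n c (i+1, j)" if "i \<in> {1..n}" "j \<in> {1..n+1}" for i j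
    using that by (intro ne) (auto simp: squares_def reflect_def adj_down)
  moreover have "mirror n c (1, i) = (i - 1) mod 3 \<and> mirror n c (i, 1) = (i - 1) mod 3 \<and>
      mirror n c (n+1, n+2-i) = (i - 1) mod 3 \<and> mirror n c (n+2-i, n+1) = (i - 1) mod 3"
    if i: "i \<in> {1..n+1}" for i
  proof -
    have i': "n + 2 - i \<in> {1..Suc n}" "n + 2 - i - 1 = Suc n - i" "i \<in> {1..Suc n}" using i by auto
    have "c (1, n + 2 - i) = (Suc n - i) mod 3" "c (i, Suc n) = (Suc n - i) mod 3"
      "c (Suc n, i) = (Suc n - i) mod 3" "c (n + 2 - i, 1) = (Suc n - i) mod 3"
      using chessboard_boundary[OF c i'(1)] chessboard_boundary[OF c i'(3)] unfolding i'(2) by blast+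
    moreover have "(1, i) \<in> squares n" "(i, 1) \<in> squares n" "(n+1, n+2-i) \<in> squares n" "(n+2-i, n+1) \<in> squares n"
      using i by (auto simp: squares_def)
    moreover have "reflect n (1, i) = (1, n + 2 - i)" "reflect n (i, 1) = (i, Suc n)"
      "reflect n (n+1, n+2-i) = (Suc n, i)" "reflect n (n+2-i, n+1) = (n + 2 - i, 1)"
      using i by (auto simp: reflect_def)
    ultimately show ?thesis using switch_boundary[OF i'(3)] unfolding mirror_def by simp
  qed
  ultimately show ?thesis unfolding chessboards_def by blast
qed

lemma mirror_mirror:
  assumes c: "c \<in> chessboards n"
  shows "mirror n (mirror n c) = c"
proof
  fix v
  show "mirror n (mirror n c) v = c v"
  proof (cases "v \<in> squares n")
    case True
    then show ?thesis
      using switch_switch[OF two_mod_three chessboard_colour[OF c True]]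
      by (simp add: mirror_def reflect_squares reflect_reflect)
  qed (simp add: mirror_def PiE_arb[OF chessboard_PiE[OF c]])
qed

text \<open>\<open>mirror\<close> is an involution of the boards and \<open>reflect\<close> one of
  the squares. This is the symmetry in the weights of the two colours other than
  \<open>2 * n mod 3\<close>.\<close>

lemma partition_sum_switch:
  "partition_sum n w = (\<Sum>c\<in>chessboards n. \<Prod>v\<in>squares n. w (switch (2 * n mod 3) (c v)))"
proof -
  have "partition_sum n w = (\<Sum>c\<in>chessboards n. \<Prod>v\<in>squares n. w (mirror n c v))"
    unfolding partition_sum_def
    by (intro sum.reindex_bij_witness[of _ "mirror n" "mirror n"])
      (simp_all add: mirror_chessboard mirror_mirror)
  also have "\<dots> = (\<Sum>c\<in>chessboards n. \<Prod>v\<in>squares n. w (switch (2 * n mod 3) (c v)))"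
  proof (rule sum.cong[OF refl])
    fix c
    show "(\<Prod>v\<in>squares n. w (mirror n c v)) = (\<Prod>v\<in>squares n. w (switch (2 * n mod 3) (c v)))"
      by (intro prod.reindex_bij_witness[of _ "reflect n" "reflect n"])
        (simp_all add: reflect_squares reflect_reflect mirror_def)
  qed
  finally show ?thesis .
qed

lemma chessboard_monomial:
  assumes c: "c \<in> chessboards n" and k: "k < 3"
  shows "\<exists>m a b. m + (a + b) = (n + 1) ^ 2 \<and> (\<forall>w :: nat \<Rightarrow> complex.
    (\<Prod>v\<in>squares n. w (c v)) = w k ^ m * (w ((k + 1) mod 3) ^ a * w ((k + 2) mod 3) ^ b) \<and>
    (\<Prod>v\<in>squares n. w (switch k (c v))) = w k ^ m * (w ((k + 2) mod 3) ^ a * w ((k + 1) mod 3) ^ b))"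
proof -
  let ?p = "(k + 1) mod 3" and ?q = "(k + 2) mod 3"
  define X where "X = off_colour n k c"
  note k = less_3_cases[OF k]
  have fin: "finite (squares n)" by (simp add: squares_def)
  have X: "X \<subseteq> squares n" by (auto simp: X_def off_colour_def)
  have "(c v = ?p \<and> switch k (c v) = ?q) \<or> (c v = ?q \<and> switch k (c v) = ?p)" if "v \<in> X" for v
    using that switch_other[OF k chessboard_colour[OF c]] unfolding X_def off_colour_def by blast
  moreover have "finite X" using X fin by (rule finite_subset)
  ultimately obtain a b where ab: "a + b = card X"
    "\<And>w :: nat \<Rightarrow> complex. (\<Prod>v\<in>X. w (c v)) = w ?p ^ a * w ?q ^ b"
    "\<And>w :: nat \<Rightarrow> complex. (\<Prod>v\<in>X. w (switch k (c v))) = w ?q ^ a * w ?p ^ b"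
    using prod_switch[of X c ?p "\<lambda>v. switch k (c v)" ?q] by blast
  have k': "c v = k" if "v \<in> squares n - X" for v
    using that unfolding X_def off_colour_def by blast
  have kk: "switch k k = k" using switch_eq_iff[OF k k] by simp
  have "(\<Prod>v\<in>squares n. w (c v)) = w k ^ card (squares n - X) * (w ?p ^ a * w ?q ^ b)" for w :: "nat \<Rightarrow> complex"
    unfolding ab(2)[symmetric] prod.subset_diff[OF X fin] by (simp add: k')
  moreover have "(\<Prod>v\<in>squares n. w (switch k (c v))) = w k ^ card (squares n - X) * (w ?q ^ a * w ?p ^ b)"
    for w :: "nat \<Rightarrow> complex"
    unfolding ab(3)[symmetric] prod.subset_diff[OF X fin] by (simp add: k' kk)
  moreover have "card (squares n - X) + (a + b) = (n + 1) ^ 2"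
    using X \<open>finite X\<close> fin card_mono[OF fin X] unfolding ab(1)
    by (simp add: card_Diff_subset) (simp add: squares_def power2_eq_square)
  ultimately show ?thesis by blast
qed

text \<open>Averaging each monomial with its switched version makes it symmetric in the two weights
  other than that of \<open>d\<close>. Such a symmetric monomial is graded, of degree equal to the
  number of squares.\<close>

lemma partition_sum_graded:
  assumes d: "d = 2 * n mod 3"
  obtains J p where "finite J"
    "\<And>w. w d \<noteq> 0 \<Longrightarrow> w ((d + 1) mod 3) \<noteq> 0 \<Longrightarrow> w ((d + 2) mod 3) \<noteq> 0 \<Longrightarrow>
      partition_sum n w = (\<Sum>j\<in>J. w d powi j * weighted (int ((n + 1) ^ 2) - j) (p j)
        (w d * w ((d + 1) mod 3) + w d * w ((d + 2) mod 3) + w ((d + 1) mod 3) * w ((d + 2) mod 3))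
        (w d * w ((d + 1) mod 3) * w ((d + 2) mod 3)))"
proof -
  have "d < 3" using d by simp
  have "\<forall>c\<in>chessboards n. \<exists>f. graded (int ((n + 1) ^ 2)) f \<and> (\<forall>w.
      ((\<Prod>v\<in>squares n. w (c v)) + (\<Prod>v\<in>squares n. w (switch d (c v)))) / 2 =
        f (w d) (w ((d + 1) mod 3)) (w ((d + 2) mod 3)))"
  proof
    fix c assume "c \<in> chessboards n"
    then obtain m a b where mab: "m + (a + b) = (n + 1) ^ 2"
      "\<And>w :: nat \<Rightarrow> complex. (\<Prod>v\<in>squares n. w (c v)) = w d ^ m * (w ((d + 1) mod 3) ^ a * w ((d + 2) mod 3) ^ b)"
      "\<And>w :: nat \<Rightarrow> complex. (\<Prod>v\<in>squares n. w (switch d (c v))) = w d ^ m * (w ((d + 2) mod 3) ^ a * w ((d + 1) mod 3) ^ b)"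
      using chessboard_monomial[OF _ \<open>d < 3\<close>] by blast
    have "graded (int (a + b) + int m) (\<lambda>t x y. (1 / 2) * (t ^ m * (x ^ a * y ^ b + y ^ a * x ^ b)))"
      by (intro graded_cmult graded_t_power graded_symmetric_monomial)
    moreover have "int (a + b) + int m = int ((n + 1) ^ 2)" unfolding mab(1)[symmetric] by simp
    ultimately have "graded (int ((n + 1) ^ 2)) (\<lambda>t x y. (1 / 2) * (t ^ m * (x ^ a * y ^ b + y ^ a * x ^ b)))"
      by (simp only:)
    moreover have "((\<Prod>v\<in>squares n. w (c v)) + (\<Prod>v\<in>squares n. w (switch d (c v)))) / 2 =
        (1 / 2) * (w d ^ m * (w ((d + 1) mod 3) ^ a * w ((d + 2) mod 3) ^ b
          + w ((d + 2) mod 3) ^ a * w ((d + 1) mod 3) ^ b))" for w :: "nat \<Rightarrow> complex"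
      unfolding mab(2,3) by (simp add: distrib_left)
    ultimately show "\<exists>f. graded (int ((n + 1) ^ 2)) f \<and> (\<forall>w.
      ((\<Prod>v\<in>squares n. w (c v)) + (\<Prod>v\<in>squares n. w (switch d (c v)))) / 2 =
        f (w d) (w ((d + 1) mod 3)) (w ((d + 2) mod 3)))"
      by (intro exI[of _ "\<lambda>t x y. (1 / 2) * (t ^ m * (x ^ a * y ^ b + y ^ a * x ^ b))"]) simp
  qed
  then obtain f where f: "\<forall>c\<in>chessboards n. graded (int ((n + 1) ^ 2)) (f c) \<and> (\<forall>w.
      ((\<Prod>v\<in>squares n. w (c v)) + (\<Prod>v\<in>squares n. w (switch d (c v)))) / 2 =
        f c (w d) (w ((d + 1) mod 3)) (w ((d + 2) mod 3)))"
    by (rule bchoice[THEN exE])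
  have sum: "partition_sum n w = (\<Sum>c\<in>chessboards n. f c (w d) (w ((d + 1) mod 3)) (w ((d + 2) mod 3)))" for w
  proof -
    have "partition_sum n w = (partition_sum n w + partition_sum n w) / 2" by simp
    also have "\<dots> = ((\<Sum>c\<in>chessboards n. \<Prod>v\<in>squares n. w (c v)) +
        (\<Sum>c\<in>chessboards n. \<Prod>v\<in>squares n. w (switch d (c v)))) / 2"
      by (subst (2) partition_sum_switch) (simp add: partition_sum_def d)
    also have "\<dots> = (\<Sum>c\<in>chessboards n. ((\<Prod>v\<in>squares n. w (c v)) + (\<Prod>v\<in>squares n. w (switch d (c v)))) / 2)"
      by (simp add: sum.distrib flip: sum_divide_distrib)
    also have "\<dots> = (\<Sum>c\<in>chessboards n. f c (w d) (w ((d + 1) mod 3)) (w ((d + 2) mod 3)))"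
      using f by (intro sum.cong refl) blast
    finally show ?thesis .
  qed
  have "graded (int ((n + 1) ^ 2)) (\<lambda>t x y. \<Sum>c\<in>chessboards n. f c t x y)"
    using f by (intro graded_sum finite_chessboards) blast
  then obtain J p where "finite J" "\<And>t x y. t \<noteq> 0 \<Longrightarrow> x \<noteq> 0 \<Longrightarrow> y \<noteq> 0 \<Longrightarrow>
      (\<Sum>c\<in>chessboards n. f c t x y) =
      (\<Sum>j\<in>J. t powi j * weighted (int ((n + 1) ^ 2) - j) (p j) (t * x + t * y + x * y) (t * x * y))"
    unfolding graded_def by blast
  with that show thesis unfolding sum by blast
qed

subsection \<open>The surviving terms\<close>

lemma cycle_sum:
  assumes "k < 3"
  shows "w k * w ((k + 1) mod 3) + w k * w ((k + 2) mod 3) + w ((k + 1) mod 3) * w ((k + 2) mod 3)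
      = w 0 * w 1 + w 0 * w 2 + w 1 * w (2 :: nat)" (is ?A)
    and "w k * w ((k + 1) mod 3) * w ((k + 2) mod 3) = w 0 * w 1 * (w 2 :: complex)" (is ?B)
proof -
  have "?A \<and> ?B"
    using less_3_cases[OF assms] by (elim insertE emptyE; hypsubst) (simp_all add: mod_Suc numeral_2_eq_2 algebra_simps)
  then show ?A ?B by blast+
qed

text \<open>Every positive real is a cube, so \<open>p\<close> has infinitely many roots. Cubes
  arise since T is s^3 when e2 = s and e3 = 1.\<close>

lemma poly_zero_cubes:
  fixes p :: "complex poly"
  assumes "\<And>s. s \<noteq> 0 \<Longrightarrow> poly p (s ^ 3) = 0"
  shows "p = 0"
proof (rule ccontr)
  assume "p \<noteq> 0"
  then have "finite {u. poly p u = 0}" by (rule poly_roots_finite)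
  moreover have "complex_of_real ` {0<..} \<subseteq> {u. poly p u = 0}"
  proof
    fix u assume "u \<in> complex_of_real ` {0<..}"
    then obtain r where r: "u = of_real r" "0 < r" by auto
    then have "u = (of_real (root 3 r)) ^ 3" by (simp flip: of_real_power)
    moreover have "complex_of_real (root 3 r) \<noteq> 0" using r by simp
    ultimately show "u \<in> {u. poly p u = 0}" using assms by simp
  qed
  ultimately have "finite (complex_of_real ` {0<..})" by (rule finite_subset[rotated])
  then have "finite {0 :: real<..}" by (rule finite_imageD) (simp add: inj_on_def)
  then show False using infinite_Ioi by blast
qed

text \<open>Insert the family of weights in which colour \<open>k\<close> has the pole. Then e2 = s
  and e3 = 1 for all z, so the expansion is a Laurent polynomial in \<open>W d\<close> with constant
  coefficients. As \<open>W d\<close> has order -2 if \<open>k = d\<close> and 1 otherwise, the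
  bound on the partition function excludes the exponent \<open>j\<close>.\<close>

lemma graded_coefficient_zero:
  assumes J: "finite J" "j \<in> J" and d: "d < 3" and k: "k < 3"
    and sum: "\<And>w. w d \<noteq> 0 \<Longrightarrow> w ((d + 1) mod 3) \<noteq> 0 \<Longrightarrow> w ((d + 2) mod 3) \<noteq> 0 \<Longrightarrow>
      partition_sum n w = (\<Sum>j\<in>J. w d powi j * weighted (N - j) (p j)
        (w d * w ((d + 1) mod 3) + w d * w ((d + 2) mod 3) + w ((d + 1) mod 3) * w ((d + 2) mod 3))
        (w d * w ((d + 1) mod 3) * w ((d + 2) mod 3)))"
    and j: "pole_order n k < (if k = d then 2 * j else - j)"
  shows "p j = 0"
proof (rule poly_zero_cubes)
  fix s :: complex assume "s \<noteq> 0"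
  obtain x y :: "real \<Rightarrow> complex" where xy:
    "\<And>z. 0 < z \<Longrightarrow> z \<le> 1 \<Longrightarrow> x z * y z = of_real z ^ 2"
    "\<And>z. 0 < z \<Longrightarrow> z \<le> 1 \<Longrightarrow> inverse (of_real z ^ 2) * (x z + y z) + x z * y z = s"
    "order_ge x 1" "order_ge y 1" "order_ge (\<lambda>z. x z + y z) 2"
    "order_ge (\<lambda>z. inverse (x z)) (- 1)" "order_ge (\<lambda>z. inverse (y z)) (- 1)"
    by (rule weight_family[of s]) (rule that; assumption)
  define W where "W a z = (if a = k then inverse (of_real z ^ 2) else if a = (k + 1) mod 3 then x z else y z)"
    for a :: nat and z :: real
  have distinct: "(k + 1) mod 3 \<noteq> k" "(k + 2) mod 3 \<noteq> k" "(k + 2) mod 3 \<noteq> (k + 1) mod 3"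
    using less_3_cases[OF k] by (elim insertE emptyE; hypsubst; simp)+
  have W: "W k = (\<lambda>z. inverse (of_real z ^ 2))" "W ((k + 1) mod 3) = x" "W ((k + 2) mod 3) = y"
    using distinct by (simp_all add: W_def fun_eq_iff)
  have pole: "order_ge (\<lambda>z. inverse (of_real z ^ 2)) (- 2)"
    unfolding order_ge_def by (intro exI[of _ 1]) (simp add: norm_inverse norm_power power_int_minus)
  have zero: "order_ge (\<lambda>z. inverse (inverse (of_real z ^ 2))) (- (- 2))"
    unfolding order_ge_def by (intro exI[of _ 1]) (simp add: norm_power)
  have nz: "W a z \<noteq> 0" if "0 < z" "z \<le> 1" for a z
    using that xy(1)[OF that] by (auto simp: W_def)
  have order: "order_ge (\<lambda>z. partition_sum n (\<lambda>a. W a z)) (- pole_order n k)"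
    by (rule order_ge_partition_sum[OF k]) (simp_all only: W pole xy)
  have "weighted (N - j) (p j) s 1 = 0"
  proof (rule laurent_coefficient_zero[OF J, of "if k = d then - 2 else 1" "W d"])
    show "order_ge (\<lambda>z. \<Sum>i\<in>J. weighted (N - i) (p i) s 1 * W d z powi i) (- pole_order n k)"
    proof (rule order_ge_cong[OF order])
      fix z :: real assume z: "0 < z" "z \<le> 1"
      let ?w = "\<lambda>a. W a z"
      have "?w 0 * ?w 1 + ?w 0 * ?w 2 + ?w 1 * ?w 2 = s"
        unfolding cycle_sum(1)[OF k, of ?w, symmetric] W using xy(2)[OF z] by (simp add: distrib_left)
      moreover have "?w 0 * ?w 1 * ?w 2 = 1"
        unfolding cycle_sum(2)[OF k, of ?w, symmetric] W using xy(1)[OF z] z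
        by (simp add: mult.assoc)
      ultimately show "partition_sum n ?w = (\<Sum>i\<in>J. weighted (N - i) (p i) s 1 * W d z powi i)"
        using sum[of ?w, OF nz[OF z] nz[OF z] nz[OF z]] unfolding cycle_sum[OF d, of ?w]
        by (simp add: mult.commute)
    qed
    have "k = d \<or> W d = x \<or> W d = y"
      by (auto simp: W_def fun_eq_iff)
    then have "k = d \<or> k \<noteq> d \<and> (W d = x \<or> W d = y)" by blast
    then show "order_ge (W d) (if k = d then - 2 else 1)"
      and "order_ge (\<lambda>z. inverse (W d z)) (- (if k = d then - 2 else 1))"
      using pole zero xy W(1) by auto
    show "(if k = d then - 2 else 1) * j < - pole_order n k" using j by auto
  qed (use nz in auto)
  then show "poly (p j) (s ^ 3) = 0" using \<open>s \<noteq> 0\<close> by (simp add: weighted_def)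
qed

text \<open>A pole in the weight of \<open>d\<close> excludes the exponents above
  \<open>l + 1\<close>; a pole in the weight of the next colour excludes those below
  \<open>l\<close>.\<close>

lemma partition_sum_two_terms:
  assumes d: "d = 2 * n mod 3" and l: "l = (if n mod 3 = 1 then - 2 else 0 :: int)"
  obtains p where "\<And>w. w 0 \<noteq> 0 \<Longrightarrow> w 1 \<noteq> 0 \<Longrightarrow> w 2 \<noteq> 0 \<Longrightarrow>
    partition_sum n w =
      w d powi l * weighted (int ((n + 1) ^ 2) - l) (p l) (w 0 * w 1 + w 0 * w 2 + w 1 * w 2) (w 0 * w 1 * w 2) +
      w d powi (l + 1) * weighted (int ((n + 1) ^ 2) - (l + 1)) (p (l + 1))
        (w 0 * w 1 + w 0 * w 2 + w 1 * w 2) (w 0 * w 1 * w 2)"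
proof -
  have "d < 3" using d by simp
  define N where "N = int ((n + 1) ^ 2)"
  obtain J p where J: "finite J" and sum:
    "\<And>w. w d \<noteq> 0 \<Longrightarrow> w ((d + 1) mod 3) \<noteq> 0 \<Longrightarrow> w ((d + 2) mod 3) \<noteq> 0 \<Longrightarrow>
      partition_sum n w = (\<Sum>j\<in>J. w d powi j * weighted (N - j) (p j)
        (w d * w ((d + 1) mod 3) + w d * w ((d + 2) mod 3) + w ((d + 1) mod 3) * w ((d + 2) mod 3))
        (w d * w ((d + 1) mod 3) * w ((d + 2) mod 3)))"
    using partition_sum_graded[OF d] unfolding N_def by blast
  \<comment> \<open>With \<open>r = n mod 3\<close> this lists \<open>d\<close> and
    \<open>(n + 1) mod 3\<close>, on which both pole orders depend.\<close>
  have "(r, 2 * r mod 3, (r + 1) mod 3) \<in> {(0, 0, 1), (1, 2, 2), (2, 1, 0)}"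
    if "r < 3" for r :: nat
    using less_3_cases[OF that] by auto
  moreover have "d = 2 * (n mod 3) mod 3" unfolding d by (simp add: mod_mult_right_eq)
  moreover have "(n + 1) mod 3 = (n mod 3 + 1) mod 3" by (simp only: mod_add_left_eq)
  moreover have "n mod 3 < 3" by simp
  ultimately have "(n mod 3, d, (n + 1) mod 3) \<in> {(0, 0, 1), (1, 2, 2), (2, 1, 0)}" by metis
  then have orders: "pole_order n d = 2 * (l + 1)" "pole_order n ((d + 1) mod 3) = - l"
    unfolding pole_order_def l by auto
  have zero: "p j = 0" if "j \<in> J" "j \<notin> {l, l + 1}" for j
  proof (cases "j < l")
    case True
    have "(d + 1) mod 3 \<noteq> d" using less_3_cases[OF \<open>d < 3\<close>] by auto
    with True orders(2) show ?thesis
      by (intro graded_coefficient_zero[OF J that(1) \<open>d < 3\<close> _ sum, of "(d + 1) mod 3"]) auto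
  next
    case False
    with that(2) show ?thesis
      by (intro graded_coefficient_zero[OF J that(1) \<open>d < 3\<close> \<open>d < 3\<close> sum]) (auto simp: orders)
  qed
  \<comment> \<open>The value 0 outside \<open>J\<close> covers the case that \<open>l\<close> or
    \<open>l + 1\<close> does not occur in the expansion.\<close>
  define q where "q j = (if j \<in> J then p j else 0)" for j
  show thesis
  proof (rule that[of q])
    fix w :: "nat \<Rightarrow> complex" assume nz: "w 0 \<noteq> 0" "w 1 \<noteq> 0" "w 2 \<noteq> 0"
    have "w a \<noteq> 0" if "a < 3" for a using less_3_cases[OF that] nz by auto
    then have "partition_sum n w = (\<Sum>j\<in>J. w d powi j * weighted (N - j) (p j)
        (w 0 * w 1 + w 0 * w 2 + w 1 * w 2) (w 0 * w 1 * w 2))"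
      using sum[of w] \<open>d < 3\<close> unfolding cycle_sum[OF \<open>d < 3\<close>, of w] by simp
    also have "\<dots> = (\<Sum>j\<in>{l, l + 1}. w d powi j * weighted (N - j) (q j)
        (w 0 * w 1 + w 0 * w 2 + w 1 * w 2) (w 0 * w 1 * w 2))"
      using J zero by (intro sum.mono_neutral_cong) (auto simp: q_def weighted_zero)
    finally show "partition_sum n w =
      w d powi l * weighted (int ((n + 1) ^ 2) - l) (q l) (w 0 * w 1 + w 0 * w 2 + w 1 * w 2) (w 0 * w 1 * w 2) +
      w d powi (l + 1) * weighted (int ((n + 1) ^ 2) - (l + 1)) (q (l + 1))
        (w 0 * w 1 + w 0 * w 2 + w 1 * w 2) (w 0 * w 1 * w 2)"
      by (simp add: N_def)
  qed
qed

lemma Z3C_eq_partition_sum: "Z3C n t0 t1 t2 = partition_sum n (colour_weight t0 t1 t2)"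
  by (simp add: Z3C_def partition_sum_def)

theorem theorem3p1:
  fixes n :: nat
  shows "\<exists>q r :: complex poly. \<forall>t0 t1 t2 :: complex. t0 \<noteq> 0 \<longrightarrow> t1 \<noteq> 0 \<longrightarrow> t2 \<noteq> 0 \<longrightarrow>
    (let e2 = t0 * t1 + t0 * t2 + t1 * t2;
         e3 = t0 * t1 * t2;
         T = e2 ^ 3 / e3 ^ 2
     in (n mod 3 = 0 \<longrightarrow>
           Z3C n t0 t1 t2 = (-1) ^ (n + 1) * e3 ^ (n * (n + 2) div 3) *
             (e2 ^ 2 / e3 * poly q T - 2 ^ of_bool (odd n) * t0 * poly r T)) \<and>
        (n mod 3 = 1 \<longrightarrow>
           Z3C n t0 t1 t2 = (-1) ^ (n + 1) * e3 ^ (n * (n + 2) div 3) *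
             (t0 * t1 / t2 * poly q T - 2 ^ of_bool (odd n) * (e2 / t2) * poly r T)) \<and>
        (n mod 3 = 2 \<longrightarrow>
           Z3C n t0 t1 t2 = (-1) ^ (n + 1) * e3 ^ ((n + 1) ^ 2 div 3) *
             (poly q T - 2 ^ of_bool (odd n) * (e2 / (t0 * t2)) * poly r T)))"
proof -
  define d where "d = 2 * n mod 3"
  define l :: int where "l = (if n mod 3 = 1 then - 2 else 0)"
  obtain p where p: "\<And>w. w 0 \<noteq> 0 \<Longrightarrow> w 1 \<noteq> 0 \<Longrightarrow> w 2 \<noteq> 0 \<Longrightarrow>
    partition_sum n w =
      w d powi l * weighted (int ((n + 1) ^ 2) - l) (p l) (w 0 * w 1 + w 0 * w 2 + w 1 * w 2) (w 0 * w 1 * w 2) +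
      w d powi (l + 1) * weighted (int ((n + 1) ^ 2) - (l + 1)) (p (l + 1))
        (w 0 * w 1 + w 0 * w 2 + w 1 * w 2) (w 0 * w 1 * w 2)"
    by (rule partition_sum_two_terms[OF d_def l_def]) (rule that)
  define \<epsilon> c :: complex where "\<epsilon> = (-1) ^ (n + 1)" and "c = 2 ^ of_bool (odd n)"
  have \<epsilon>: "\<epsilon> * (\<epsilon> * u) = u" for u
    by (simp add: \<epsilon>_def flip: mult.assoc power_add)
  have c: "c \<noteq> 0" by (simp add: c_def)
  \<comment> \<open>The sign and the power of 2 are nonzero constants, so they are absorbed into the
    polynomials.\<close>
  let ?q = "smult \<epsilon> (p l)" and ?r = "smult (- \<epsilon> / c) (p (l + 1))"
  have combine: "\<epsilon> * E * (A * poly ?q T - c * B * poly ?r T) = E * A * poly (p l) T + E * B * poly (p (l + 1)) T"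
    for E A B T
  proof -
    have "\<epsilon> * E * (A * poly ?q T - c * B * poly ?r T) =
        \<epsilon> * (\<epsilon> * (E * A * poly (p l) T + E * B * poly (p (l + 1)) T))"
      using c by (simp add: field_simps)
    then show ?thesis by (simp only: \<epsilon>)
  qed
  show ?thesis
  proof (rule exI[of _ ?q], rule exI[of _ ?r], intro allI impI)
    fix t0 t1 t2 :: complex
    assume nz: "t0 \<noteq> 0" "t1 \<noteq> 0" "t2 \<noteq> 0"
    define e2 e3 T where "e2 = t0 * t1 + t0 * t2 + t1 * t2" and "e3 = t0 * t1 * t2" and "T = e2 ^ 3 / e3 ^ 2"
    have "e3 \<noteq> 0" using nz by (simp add: e3_def)
    let ?w = "colour_weight t0 t1 t2"
    have w: "?w 0 = t0" "?w 1 = t1" "?w 2 = t2" by (simp_all add: colour_weight_def)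
    have Z: "Z3C n t0 t1 t2 =
      ?w d powi l * weighted (int ((n + 1) ^ 2) - l) (p l) e2 e3 +
      ?w d powi (l + 1) * weighted (int ((n + 1) ^ 2) - (l + 1)) (p (l + 1)) e2 e3"
      unfolding Z3C_eq_partition_sum using p[of ?w] nz unfolding w e2_def e3_def by blast
    have "Z3C n t0 t1 t2 = e3 ^ (n * (n + 2) div 3) * (e2 ^ 2 / e3) * poly (p l) T
        + e3 ^ (n * (n + 2) div 3) * t0 * poly (p (l + 1)) T" if n: "n mod 3 = 0"
    proof -
      obtain i where i: "n = 3 * i" using n by (metis mult_div_mod_eq add_0_right)
      define K where "K = i * (n + 2)"
      have "n * (n + 2) = 3 * K" using i by (simp add: K_def)
      then have I: "n * (n + 2) div 3 = K" "int (n * (n + 2)) = 3 * int K" by simp_all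
      have N: "int ((n + 1) ^ 2) - l = 3 * int K + 1" "int ((n + 1) ^ 2) - (l + 1) = 3 * int K"
        using n I(2) by (simp_all add: l_def power2_eq_square)
      have "?w d = t0" using i w by (simp add: d_def)
      moreover have "l = 0" using n by (simp add: l_def)
      ultimately show ?thesis
        unfolding Z N weighted_def exp_values I(1) T_def[symmetric] using \<open>e3 \<noteq> 0\<close>
        by (simp add: power_int_diff field_simps)
    qed
    moreover have "Z3C n t0 t1 t2 = e3 ^ (n * (n + 2) div 3) * (t0 * t1 / t2) * poly (p l) T
        + e3 ^ (n * (n + 2) div 3) * (e2 / t2) * poly (p (l + 1)) T" if n: "n mod 3 = 1"
    proof -
      obtain i where i: "n = 3 * i + 1" using n by (metis mult_div_mod_eq)
      define K where "K = n * (i + 1)"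
      have "n * (n + 2) = 3 * K" using i by (simp add: K_def algebra_simps)
      then have I: "n * (n + 2) div 3 = K" "int (n * (n + 2)) = 3 * int K" by simp_all
      have N: "int ((n + 1) ^ 2) - l = 3 * (int K + 1)" "int ((n + 1) ^ 2) - (l + 1) = 3 * int K + 2"
        using n I(2) by (simp_all add: l_def power2_eq_square)
      have "d = 2" using n mod_mult_right_eq[of 2 n 3] by (simp add: d_def)
      with w have "?w d = t2" by simp
      moreover have "l = - 2" using n by (simp add: l_def)
      \<comment> \<open>The exponents of t2 are -2 and -1 here; one factor e3 turns t2^(-2) into t0
        t1 / t2.\<close>
      moreover have "t2 powi - 2 * (e3 powi (int K + 1)) = e3 ^ K * (t0 * t1 / t2)"
        using \<open>e3 \<noteq> 0\<close> nz(3)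
        by (simp add: power_int_add power_int_minus e3_def field_simps power2_eq_square)
      moreover have "t2 powi (- 2 + 1) * (e2 * e3 powi int K) = e3 ^ K * (e2 / t2)"
        by (simp add: power_int_minus field_simps)
      ultimately show ?thesis
        unfolding Z N weighted_def exp_values I(1) T_def[symmetric]
        by (simp only: power_0 power_one_right mult_1 mult.assoc[symmetric])
    qed
    moreover have "Z3C n t0 t1 t2 = e3 ^ ((n + 1) ^ 2 div 3) * 1 * poly (p l) T
        + e3 ^ ((n + 1) ^ 2 div 3) * (e2 / (t0 * t2)) * poly (p (l + 1)) T" if n: "n mod 3 = 2"
    proof -
      obtain i where i: "n = 3 * i + 2" using n by (metis mult_div_mod_eq)
      define K where "K = (n + 1) * (i + 1)"
      have "(n + 1) ^ 2 = 3 * K" using i by (simp add: K_def power2_eq_square algebra_simps)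
      then have I: "(n + 1) ^ 2 div 3 = K" "int ((n + 1) ^ 2) = 3 * int K" by simp_all
      have N: "int ((n + 1) ^ 2) - l = 3 * int K" "int ((n + 1) ^ 2) - (l + 1) = 3 * (int K - 1) + 2"
        using n I(2) by (simp_all add: l_def)
      have "d = 1" using n mod_mult_right_eq[of 2 n 3] by (simp add: d_def)
      with w have "?w d = t1" by simp
      moreover have "l = 0" using n by (simp add: l_def)
      \<comment> \<open>The distinguished weight is t1, and t1 / e3 equals 1 / (t0 t2).\<close>
      moreover have "t1 * (e2 * e3 powi (int K - 1)) = e3 ^ K * (e2 / (t0 * t2))"
        using \<open>e3 \<noteq> 0\<close> nz by (simp add: power_int_diff e3_def field_simps)
      ultimately show ?thesis
        unfolding Z N weighted_def exp_values I(1) T_def[symmetric]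
        by (simp add: mult.assoc[symmetric])
    qed
    ultimately show "let e2 = t0 * t1 + t0 * t2 + t1 * t2; e3 = t0 * t1 * t2; T = e2 ^ 3 / e3 ^ 2
     in (n mod 3 = 0 \<longrightarrow>
           Z3C n t0 t1 t2 = (-1) ^ (n + 1) * e3 ^ (n * (n + 2) div 3) *
             (e2 ^ 2 / e3 * poly ?q T - 2 ^ of_bool (odd n) * t0 * poly ?r T)) \<and>
        (n mod 3 = 1 \<longrightarrow>
           Z3C n t0 t1 t2 = (-1) ^ (n + 1) * e3 ^ (n * (n + 2) div 3) *
             (t0 * t1 / t2 * poly ?q T - 2 ^ of_bool (odd n) * (e2 / t2) * poly ?r T)) \<and>
        (n mod 3 = 2 \<longrightarrow>
           Z3C n t0 t1 t2 = (-1) ^ (n + 1) * e3 ^ ((n + 1) ^ 2 div 3) *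
             (poly ?q T - 2 ^ of_bool (odd n) * (e2 / (t0 * t2)) * poly ?r T))"
      unfolding Let_def e2_def[symmetric] e3_def[symmetric] T_def[symmetric] \<epsilon>_def[symmetric] c_def[symmetric]
        combine combine[of _ 1, unfolded mult_1] by blast
  qed
qed

end
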